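(* Let $Q$ be a generalized $n$-permutohedron in $\mathbb{R}^n$. Then: (i) the power series $F(Q,\mathbf{x})=\sum_{f:[n]\to\mathbb{P}\ Q\text{-generic}}\mathbf{x}_f$ is quasisymmetric; (ii) there are strictly labelled posets $(P_v,\gamma_v)$ on $n$ elements, indexed by the vertices $v$ of $Q$, such that $F(Q,\mathbf{x})=\sum_{v\text{ vertex of }Q}F(P_v,\gamma_v,\mathbf{x})$; (iii) the coefficients $c^Q_\alpha$ in the expansion $F(Q,\mathbf{x})=\sum_\alpha c^Q_\alpha L_\alpha$ (a) are nonnegative, (b) sum to $n!$, and (c) $c^Q_{(1,1,\ldots,1)}$ equals the number of vertices of $Q$; (iv) $S(F(Q,\mathbf{x}))=(-1)^nF^\ast(Q,\mathbf{x})$, where $F^\ast(Q,\mathbf{x})=\sum_{f:[n]\to\mathbb{P}}|\{f\text{-minimizing vertices of }Q\}|\,\mathbf{x}_f$; (v) the polynomials $\phi(Q,m)$, $\phi^\ast(Q,m)$ in $m$ obtained by specializing $F(Q,\mathbf{x})$, $F^\ast(Q,\mathbf{x})$ at $x_1=\cdots=x_m=1$, $x_{m+1}=x_{m+2}=\cdots=0$ satisfy $\phi(Q,-m)=(-1)^n\phi^\ast(Q,m)$; (vi) if $Q=\bigcup_iQ_i$ is a decomposition of $Q$ into finitely many generalized $n$-permutohedra $Q_i$ in which $Q_i\cap Q_j$ is a common face of $Q_i$ and $Q_j$ for all $i,j$, then $$F(Q,\mathbf{x})=\sum_{j\ge1}(-1)^{j-1}\sum_{i_1<\cdots<i_j}F(Q_{i_1}\cap\cdots\cap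 Q_{i_j},\mathbf{x}),$$ where the sum is over those terms with $Q_{i_1}\cap\cdots\cap Q_{i_j}$ nonempty.
   Context: A convex polytope $Q\subset\mathbb{R}^n$ is a generalized $n$-permutohedron if every edge of $Q$ is parallel to some $e_i-e_j$ ($i\ne j$, standard basis vectors); equivalently its normal fan is refined by the braid arrangement. A function $f:[n]\to\mathbb{P}=\{1,2,\ldots\}$ is regarded as the linear functional $v\mapsto\sum_i f(i)v_i$; a vertex $v$ of $Q$ is $f$-minimizing if it minimizes this functional over $Q$, and $f$ is $Q$-generic if this minimum over $Q$ is attained uniquely at a vertex. $\mathbf{x}_f=\prod_{i=1}^nx_{f(i)}$. A labelled poset $(P,\gamma)$ on $n$ elements has a bijection $\gamma:P\to[n]$, strict if $\gamma(p)>\gamma(p')$ whenever $p<p'$; a $(P,\gamma)$-partition is $f:P\to\mathbb{P}$ with $f(p)\le f(p')$ when $p\le p'$ and $f(p)<f(p')$ when $p\le p'$ and $\gamma(p)>\gamma(p')$; $F(P,\gamma,\mathbf{x})=\sum_f\prod_px_{f(p)}$ over $(P,\gamma)$-partitions. For compositions $\alpha$, $M_\alpha=\sum_{i_1<\cdots<i_k}x_{i_1}^{\alpha_1}\cdots x_{i_k}^{\alpha_k}$ and $L_\alpha=\sum_{\beta\text{ refining }\alpha}M_\beta$. $S$ is the antipode of the Hopf algebra of quasisymmetric functions (coproduct given by splitting the ordered alphabet $x_1<x_2<\cdots<y_1<y_2<\cdots$); explicitly $S(L_\alpha)=(-1)^{|\alpha|}L_{\alpha^c}$, where $\alpha^c$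 is the composition of $|\alpha|$ whose set of partial sums is the complement in $[|\alpha|-1]$ of that of $\alpha$.
   Formalization: In (vi) it is also assumed that every vertex of each Q_i is a vertex of Q; without this the formula fails (a segment cut at its midpoint). In (iv), S is the linear map S(L_α)=(-1)^{|α|}L_{α^c} (no reversal of α), for which the identity holds. *)

theory Defs
  imports
    "HOL-Analysis.Analysis"
    "HOL-Library.Multiset"
    "HOL-Computational_Algebra.Polynomial"
begin

text \<open>
  A monomial in the variables $x_1, x_2, \ldots$ is the multiset of the indices of its variables,
  and a formal power series is its function of coefficients. The index 0 never occurs.
\<close>

type_synonym monomial = "nat multiset"
type_synonym fpseries = "monomial \<Rightarrow> int"

text \<open>
  The possibly infinite sum of the terms \<open>w s\<close> times \<open>mon s\<close> over \<open>s \<in> A\<close>.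
  It is only used where each monomial is the value of \<open>mon\<close> at finitely many \<open>s \<in> A\<close>.
\<close>

definition formal_sum :: "'s set \<Rightarrow> ('s \<Rightarrow> int) \<Rightarrow> ('s \<Rightarrow> monomial) \<Rightarrow> fpseries" where
  "formal_sum A w mon = (\<lambda>m. \<Sum>s\<in>{s \<in> A. mon s = m}. w s)"

definition pos_maps :: "('p \<Rightarrow> nat) set" where
  "pos_maps = {f. \<forall>p. 1 \<le> f p}"

definition x_mon :: "('p::finite \<Rightarrow> nat) \<Rightarrow> monomial" where
  "x_mon f = (\<Sum>p\<in>UNIV. {#f p#})"


subsection \<open>Quasisymmetric functions\<close>

definition composition :: "nat list \<Rightarrow> bool" where
  "composition \<alpha> \<longleftrightarrow> 0 \<notin> set \<alpha>"

text \<open>The partial sums of \<open>\<alpha>\<close> other than 0 and $|\alpha|$, a subset of $[|\alpha| - 1]$.\<close>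

definition partial_sums :: "nat list \<Rightarrow> nat set" where
  "partial_sums \<alpha> = {sum_list (take i \<alpha>) | i. 1 \<le> i \<and> i < length \<alpha>}"

definition refines :: "nat list \<Rightarrow> nat list \<Rightarrow> bool" where
  "refines \<beta> \<alpha> \<longleftrightarrow> composition \<beta> \<and> sum_list \<beta> = sum_list \<alpha> \<and> partial_sums \<alpha> \<subseteq> partial_sums \<beta>"

definition comp_complement :: "nat list \<Rightarrow> nat list" where
  "comp_complement \<alpha> = (THE \<beta>. composition \<beta> \<and> sum_list \<beta> = sum_list \<alpha> \<and>
     partial_sums \<beta> = {1..<sum_list \<alpha>} - partial_sums \<alpha>)"

definition increasing_indices :: "nat \<Rightarrow> nat list set" where
  "increasing_indices k = {js. length js = k \<and> sorted_wrt (<) js \<and> 0 \<notin> set js}"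

text \<open>$x_{j_1}^{\alpha_1} \cdots x_{j_k}^{\alpha_k}$\<close>

definition power_mon :: "nat list \<Rightarrow> nat list \<Rightarrow> monomial" where
  "power_mon \<alpha> js = sum_list (map2 (\<lambda>j a. replicate_mset a j) js \<alpha>)"

definition quasisymmetric :: "fpseries \<Rightarrow> bool" where
  "quasisymmetric F \<longleftrightarrow>
     (\<forall>m. F m \<noteq> 0 \<longrightarrow> 0 \<notin># m) \<and>
     (\<exists>d. \<forall>m. F m \<noteq> 0 \<longrightarrow> size m \<le> d) \<and>
     (\<forall>\<alpha>. composition \<alpha> \<longrightarrow>
        (\<forall>is \<in> increasing_indices (length \<alpha>). \<forall>js \<in> increasing_indices (length \<alpha>).
           F (power_mon \<alpha> is) = F (power_mon \<alpha> js)))"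

definition M_fun :: "nat list \<Rightarrow> fpseries" where
  "M_fun \<alpha> = formal_sum (increasing_indices (length \<alpha>)) (\<lambda>_. 1) (power_mon \<alpha>)"

definition L_fun :: "nat list \<Rightarrow> fpseries" where
  "L_fun \<alpha> = (\<lambda>m. \<Sum>\<beta> | refines \<beta> \<alpha>. M_fun \<beta> m)"

definition L_expansion :: "fpseries \<Rightarrow> (nat list \<Rightarrow> int) \<Rightarrow> bool" where
  "L_expansion F c \<longleftrightarrow>
     finite {\<alpha>. c \<alpha> \<noteq> 0} \<and> (\<forall>\<alpha>. c \<alpha> \<noteq> 0 \<longrightarrow> composition \<alpha>) \<and>
     F = (\<lambda>m. \<Sum>\<alpha> | c \<alpha> \<noteq> 0. c \<alpha> * L_fun \<alpha> m)"

definition L_coeff :: "fpseries \<Rightarrow> nat list \<Rightarrow> int" where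
  "L_coeff F = (THE c. L_expansion F c)"

text \<open>
  The linear map with $S(L_\alpha) = (-1)^{|\alpha|} L_{\alpha^c}$, where $\alpha^c$ is the
  complement of $\alpha$ without reversal. The convolution inverse of the identity for the
  coproduct that splits the alphabet into $x_1 < x_2 < \cdots < y_1 < y_2 < \cdots$ is the
  composite of this map with $L_\alpha \mapsto L_{\mathrm{rev}(\alpha)}$; that variant turns
  minimizing vertices into maximizing ones.
\<close>

definition antipode :: "fpseries \<Rightarrow> fpseries" where
  "antipode F = (\<lambda>m. \<Sum>\<alpha> | L_coeff F \<alpha> \<noteq> 0.
     L_coeff F \<alpha> * ((-1) ^ sum_list \<alpha> * L_fun (comp_complement \<alpha>) m))"

text \<open>
  The value at $x_1 = \cdots = x_k = 1$, $x_{k+1} = x_{k+2} = \cdots = 0$, for series of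
  bounded degree.
\<close>

definition specialize :: "fpseries \<Rightarrow> nat \<Rightarrow> int" where
  "specialize F k = (\<Sum>m | F m \<noteq> 0 \<and> set_mset m \<subseteq> {1..k}. F m)"


subsection \<open>Labelled posets\<close>

definition labelled_poset :: "'p::finite rel \<Rightarrow> ('p \<Rightarrow> nat) \<Rightarrow> bool" where
  "labelled_poset P \<gamma> \<longleftrightarrow> partial_order_on UNIV P \<and> bij_betw \<gamma> UNIV {1..CARD('p)}"

definition strictly_labelled_poset :: "'p::finite rel \<Rightarrow> ('p \<Rightarrow> nat) \<Rightarrow> bool" where
  "strictly_labelled_poset P \<gamma> \<longleftrightarrow>
     labelled_poset P \<gamma> \<and> (\<forall>p q. (p, q) \<in> P \<and> p \<noteq> q \<longrightarrow> \<gamma> p > \<gamma> q)"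

definition P_partitions :: "'p rel \<Rightarrow> ('p \<Rightarrow> nat) \<Rightarrow> ('p \<Rightarrow> nat) set" where
  "P_partitions P \<gamma> = {f \<in> pos_maps. \<forall>p q. (p, q) \<in> P \<longrightarrow>
     f p \<le> f q \<and> (\<gamma> p > \<gamma> q \<longrightarrow> f p < f q)}"

definition F_poset :: "'p::finite rel \<Rightarrow> ('p \<Rightarrow> nat) \<Rightarrow> fpseries" where
  "F_poset P \<gamma> = formal_sum (P_partitions P \<gamma>) (\<lambda>_. 1) x_mon"


subsection \<open>Generalized permutohedra\<close>

definition generalized_permutohedron :: "(real ^ 'n) set \<Rightarrow> bool" where
  "generalized_permutohedron Q \<longleftrightarrow>
     polytope Q \<and> Q \<noteq> {} \<and>
     (\<forall>e. e edge_of Q \<longrightarrow>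
        (\<exists>i j. i \<noteq> j \<and> (\<forall>x\<in>e. \<forall>y\<in>e. \<exists>c. x - y = c *\<^sub>R (axis i 1 - axis j 1))))"

definition vertices :: "(real ^ 'n) set \<Rightarrow> (real ^ 'n) set" where
  "vertices Q = {v. v extreme_point_of Q}"

definition functional :: "('n::finite \<Rightarrow> nat) \<Rightarrow> real ^ 'n \<Rightarrow> real" where
  "functional f v = (\<Sum>i\<in>UNIV. real (f i) * v $ i)"

definition minimizers :: "(real ^ 'n) set \<Rightarrow> ('n::finite \<Rightarrow> nat) \<Rightarrow> (real ^ 'n) set" where
  "minimizers Q f = {v \<in> Q. \<forall>w\<in>Q. functional f v \<le> functional f w}"

definition generic :: "(real ^ 'n) set \<Rightarrow> ('n::finite \<Rightarrow> nat) \<Rightarrow> bool" where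
  "generic Q f \<longleftrightarrow> (\<exists>v \<in> vertices Q. minimizers Q f = {v})"

definition F_poly :: "(real ^ 'n::finite) set \<Rightarrow> fpseries" where
  "F_poly Q = formal_sum {f \<in> pos_maps. generic Q f} (\<lambda>_. 1) x_mon"

definition F_star :: "(real ^ 'n::finite) set \<Rightarrow> fpseries" where
  "F_star Q = formal_sum pos_maps (\<lambda>f. int (card (vertices Q \<inter> minimizers Q f))) x_mon"

text \<open>
  Inclusion-exclusion for $F$ needs this condition on a decomposition of \<open>Q\<close> into
  \<open>R 1, \<dots>, R k\<close>. If the segment from $e_2 - e_1$ to $e_1 - e_2$ is cut at 0, then only
  the intersection $\{0\}$ of the two pieces contributes to the coefficient of $x_1^2$, so the
  alternating sum has coefficient $-1$ there, and $F$ of the whole segment has coefficient 0.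
\<close>

definition without_new_vertices :: "(real ^ 'n) set \<Rightarrow> nat \<Rightarrow> (nat \<Rightarrow> (real ^ 'n) set) \<Rightarrow> bool" where
  "without_new_vertices Q k R \<longleftrightarrow> (\<forall>i\<in>{1..k}. vertices (R i) \<subseteq> vertices Q)"

end

theory Submission
  imports Defs "HOL-Combinatorics.Multiset_Permutations"
begin

text \<open>
  At a vertex \<open>v\<close> of \<open>Q\<close>, the pairs \<open>(i, j)\<close> for which one can move from \<open>v\<close> a little in
  direction $e_j - e_i$ inside \<open>Q\<close> form a partial order. Because a polytope has an improving edge at
  every vertex that is not optimal, \<open>v\<close> minimizes \<open>f\<close> iff \<open>f\<close> is weakly increasing for this order,
  and uniquely so iff \<open>f\<close> is strictly increasing. So both $F(Q)$ and $F^*(Q)$ are sums over the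
  vertices of generating functions of \<open>P\<close>-partitions, for opposite labellings of the same posets, and
  the linear extensions of all vertex orders together are the $n!$ linear orders. Sorting the
  partitions by standardization yields the expansion into $L_\alpha$; reversing the labels complements
  all descent sets, which is the effect of the antipode and of $m \mapsto -m$.

  For the decomposition formula, cut off a vertex \<open>v\<close> by a hyperplane \<open>H\<close>. It is the unique minimum
  of \<open>f\<close> over a piece \<open>S\<close> containing it iff the compact convex set of all \<open>x\<close> in \<open>S \<inter> H\<close> with
  $f(x) \le f(v)$ is empty, and the Euler characteristic (1 on nonempty compact convex sets) is
  additive.
\<close>

subsection \<open>Compositions and fundamental quasisymmetric functions\<close>

text \<open>At a monomial of degree n without the index 0, L_\<alpha> has coefficient 1 if the
  partial sums of \<alpha> are among the positions at which the sorted list of indices increases,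
  and 0 otherwise. Compositions, descent sets and monomials are therefore all handled as subsets of
  \<open>{1..<n}\<close>, and both the antipode and the substitution of -m become complementation of
  such subsets. The hyperplane in the decomposition formula is there because the set of all x in S
  other than v with f(x) \<le> f(v) need not be closed: it contains with x the whole segment up to
  v, but not v. Its slice by H is compact and convex, and it is empty exactly when there is no such
  x. The same slice of Q is the vertex figure that yields the improving edges. The Euler
  characteristic enters only through one consequence: if an integer combination of indicators of
  compact convex sets vanishes at every point, then the coefficients of the nonempty sets sum to
  0.\<close>

text \<open>With a general relation it covers both the descents of a permutation and the strict
  increases of a sorted list, which are to be compared as sets. A break is recorded as the length of
  the prefix before it, to match \<open>partial_sums\<close>.\<close>

definition breaks :: "('a \<Rightarrow> 'a \<Rightarrow> bool) \<Rightarrow> 'a list \<Rightarrow> nat set" where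
  "breaks R xs = {Suc i | i. Suc i < length xs \<and> R (xs ! i) (xs ! Suc i)}"

abbreviation mset_breaks :: "monomial \<Rightarrow> nat set" where
  "mset_breaks m \<equiv> breaks (<) (sorted_list_of_multiset m)"

lemma breaks_subset: "breaks R xs \<subseteq> {1..<length xs}"
  by (auto simp: breaks_def)

lemma Suc_mem_breaks_iff: "Suc i \<in> breaks R xs \<longleftrightarrow> Suc i < length xs \<and> R (xs ! i) (xs ! Suc i)"
  by (auto simp: breaks_def)

lemma partial_sums_simps [simp]:
  "partial_sums [] = {}" "partial_sums [a] = {}"
  by (auto simp: partial_sums_def)

text \<open>For empty \<beta> the sum a would be the total, which does not count as a partial
  sum.\<close>

lemma partial_sums_Cons:
  assumes "\<beta> \<noteq> []"
  shows "partial_sums (a # \<beta>) = insert a ((+) a ` partial_sums \<beta>)"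
proof (intro set_eqI iffI)
  fix s assume "s \<in> partial_sums (a # \<beta>)"
  then obtain i where i: "s = sum_list (take i (a # \<beta>))" "1 \<le> i" "i < Suc (length \<beta>)"
    by (auto simp: partial_sums_def)
  then show "s \<in> insert a ((+) a ` partial_sums \<beta>)"
    by (cases i; cases "i = 1") (auto simp: partial_sums_def image_iff)
next
  fix s assume "s \<in> insert a ((+) a ` partial_sums \<beta>)"
  then consider "s = a" | i where "s = a + sum_list (take i \<beta>)" "1 \<le> i" "i < length \<beta>"
    by (auto simp: partial_sums_def)
  then show "s \<in> partial_sums (a # \<beta>)"
  proof cases
    case 1
    then show ?thesis
      using assms by (auto simp: partial_sums_def intro!: exI[of _ 1])
  next
    case 2
    then show ?thesis
      by (auto simp: partial_sums_def intro!: exI[of _ "Suc i"])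
  qed
qed

lemma composition_simps [simp]:
  "composition []" "composition (a # \<alpha>) \<longleftrightarrow> 0 < a \<and> composition \<alpha>"
  by (auto simp: composition_def)

text \<open>The same recursion as in \<open>partial_sums_Cons\<close>; this is what makes the breaks
  of a monomial agree with the partial sums of its exponents.\<close>

lemma breaks_replicate_append:
  assumes "0 < a" "ys \<noteq> []" "\<And>y. y \<in> set ys \<Longrightarrow> j < y"
  shows "breaks (<) (replicate a (j::'a::linorder) @ ys) = insert a ((+) a ` breaks (<) ys)"
proof (intro set_eqI iffI)
  fix s assume "s \<in> breaks (<) (replicate a j @ ys)"
  then obtain i where i: "s = Suc i" "Suc i < a + length ys"
      "(replicate a j @ ys) ! i < (replicate a j @ ys) ! Suc i"
    by (auto simp: breaks_def)
  consider "Suc i < a" | "Suc i = a" | "i \<ge> a"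
    by linarith
  then show "s \<in> insert a ((+) a ` breaks (<) ys)"
  proof cases
    case 1
    then show ?thesis using i by (simp add: nth_append)
  next
    case 2
    then show ?thesis using i by simp
  next
    case 3
    then have "Suc (i - a) \<in> breaks (<) ys"
      using i by (auto simp: Suc_mem_breaks_iff nth_append Suc_diff_le)
    moreover have "s = a + Suc (i - a)"
      using i 3 by simp
    ultimately show ?thesis by blast
  qed
next
  fix s assume "s \<in> insert a ((+) a ` breaks (<) ys)"
  then consider "s = a" | i where "s = a + Suc i" "Suc i < length ys" "ys ! i < ys ! Suc i"
    by (auto simp: breaks_def)
  then show "s \<in> breaks (<) (replicate a j @ ys)"
  proof cases
    case 1
    obtain b where "a = Suc b"
      using assms(1) by (cases a) auto
    then have "(replicate a j @ ys) ! b = j" "(replicate a j @ ys) ! Suc b = ys ! 0"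
      by (simp_all add: nth_append del: replicate_Suc)
    then show ?thesis
      using assms 1 \<open>a = Suc b\<close> by (auto simp: Suc_mem_breaks_iff simp del: replicate_Suc)
  next
    case 2
    then show ?thesis
      using Suc_mem_breaks_iff[of "a + i" "(<)" "replicate a j @ ys"]
      by (auto simp: nth_append)
  qed
qed

lemma breaks_replicate [simp]: "breaks (<) (replicate a (j::'a::linorder)) = {}"
  by (auto simp: breaks_def)

text \<open>The list form of \<open>power_mon\<close>. For strictly increasing \<open>js\<close> and
  positive exponents it is already sorted, so the breaks of the monomial can be computed by
  induction on it.\<close>

definition run_list :: "nat list \<Rightarrow> nat list \<Rightarrow> nat list" where
  "run_list \<alpha> js = concat (map2 (\<lambda>j a. replicate a j) js \<alpha>)"

lemma mset_run_list: "mset (run_list \<alpha> js) = power_mon \<alpha> js"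
  by (simp add: run_list_def power_mon_def mset_concat case_prod_unfold comp_def)

lemma set_run_list:
  assumes "length js = length \<alpha>" "composition \<alpha>"
  shows "set (run_list \<alpha> js) = set js"
  using assms by (induction js \<alpha> rule: list_induct2) (auto simp: run_list_def)

lemma sorted_run_list:
  assumes "length js = length \<alpha>" "sorted_wrt (<) js" "composition \<alpha>"
  shows "sorted (run_list \<alpha> js)"
  using assms
proof (induction js \<alpha> rule: list_induct2)
  case (Cons j js a \<alpha>)
  then have "set (run_list \<alpha> js) = set js"
    by (intro set_run_list) auto
  then show ?case
    using Cons by (auto simp: run_list_def sorted_append less_imp_le)
qed (simp add: run_list_def)

lemma breaks_run_list:
  assumes "length js = length \<alpha>" "sorted_wrt (<) js" "composition \<alpha>"
  shows "breaks (<) (run_list \<alpha> js) = partial_sums \<alpha>"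
  using assms
proof (induction js \<alpha> rule: list_induct2)
  case (Cons j js a \<alpha>)
  show ?case
  proof (cases "\<alpha> = []")
    case True
    then show ?thesis using Cons by (simp add: run_list_def)
  next
    case False
    have set: "set (run_list \<alpha> js) = set js"
      using Cons by (intro set_run_list) auto
    then have "run_list \<alpha> js \<noteq> []"
      using False Cons.hyps by (metis length_0_conv set_empty)
    then have "breaks (<) (run_list (a # \<alpha>) (j # js))
        = insert a ((+) a ` breaks (<) (run_list \<alpha> js))"
      using Cons set breaks_replicate_append[of a "run_list \<alpha> js" j]
      by (simp add: run_list_def)
    then show ?thesis
      using Cons partial_sums_Cons[OF False] by simp
  qed
qed (simp add: run_list_def breaks_def)

lemma sorted_list_of_power_mon:
  assumes "length js = length \<alpha>" "sorted_wrt (<) js" "composition \<alpha>"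
  shows "sorted_list_of_multiset (power_mon \<alpha> js) = run_list \<alpha> js"
  using sorted_run_list[OF assms] mset_run_list
  by (metis sorted_list_of_multiset_mset sorted_sort_id)

lemma size_power_mon:
  assumes "length js = length \<alpha>"
  shows "size (power_mon \<alpha> js) = sum_list \<alpha>"
  using assms by (induction js \<alpha> rule: list_induct2) (auto simp: power_mon_def)

lemma mset_breaks_power_mon:
  assumes "js \<in> increasing_indices (length \<alpha>)" "composition \<alpha>"
  shows "mset_breaks (power_mon \<alpha> js) = partial_sums \<alpha>"
  using assms breaks_run_list sorted_list_of_power_mon by (simp add: increasing_indices_def)

lemma set_power_mon:
  assumes "length js = length \<alpha>" "composition \<alpha>"
  shows "set_mset (power_mon \<alpha> js) = set js"
  using set_run_list[OF assms] by (metis mset_run_list set_mset_mset)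

lemma count_power_mon:
  assumes "length js = length \<alpha>" "distinct js"
  shows "map (count (power_mon \<alpha> js)) js = \<alpha>"
  using assms
proof (induction js \<alpha> rule: list_induct2)
  case (Cons j js a \<alpha>)
  have *: "power_mon (a # \<alpha>) (j # js) = replicate_mset a j + power_mon \<alpha> js"
    by (simp add: power_mon_def)
  have "set (run_list \<alpha> js) \<subseteq> set js"
    using Cons.hyps by (auto simp: run_list_def set_zip)
  then have "j \<notin># power_mon \<alpha> js"
    using Cons.prems by (auto simp flip: mset_run_list)
  then have "count (power_mon (a # \<alpha>) (j # js)) j = a"
    by (simp add: * count_eq_zero_iff)
  moreover have "map (count (power_mon (a # \<alpha>) (j # js))) js = \<alpha>"
  proof -
    have "map (count (power_mon (a # \<alpha>) (j # js))) js = map (count (power_mon \<alpha> js)) js"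
      using Cons.prems by (intro map_cong) (auto simp: *)
    also have "\<dots> = \<alpha>"
      using Cons by simp
    finally show ?thesis .
  qed
  ultimately show ?case
    by simp
qed simp

text \<open>Together with the sorted support this inverts \<open>power_mon\<close>.\<close>

definition exponents :: "monomial \<Rightarrow> nat list" where
  "exponents m = map (count m) (sorted_list_of_set (set_mset m))"

lemma power_mon_exponents: "power_mon (exponents m) (sorted_list_of_set (set_mset m)) = m"
proof -
  have *: "power_mon (map g js) js = (\<Sum>j\<leftarrow>js. replicate_mset (g j) j)" for g js
    by (induction js) (auto simp: power_mon_def)
  have "power_mon (exponents m) (sorted_list_of_set (set_mset m))
      = (\<Sum>j\<in>set_mset m. replicate_mset (count m j) j)"
    unfolding exponents_def * by (subst sum_list_distinct_conv_sum_set) auto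
  also have "\<dots> = m"
    by (intro multiset_eqI) (auto simp: count_sum not_in_iff)
  finally show ?thesis .
qed

lemma composition_exponents: "composition (exponents m)"
  by (auto simp: exponents_def composition_def simp flip: count_greater_zero_iff)

lemma exponents_power_mon:
  assumes "composition \<beta>" "js \<in> increasing_indices (length \<beta>)"
  shows "exponents (power_mon \<beta> js) = \<beta>" "sorted_list_of_set (set_mset (power_mon \<beta> js)) = js"
proof -
  have js: "length js = length \<beta>" "sorted_wrt (<) js"
    using assms(2) by (auto simp: increasing_indices_def)
  show "sorted_list_of_set (set_mset (power_mon \<beta> js)) = js"
    using js assms(1)
    by (simp add: set_power_mon sorted_list_of_set.idem_if_sorted_distinct strict_sorted_iff)
  then show "exponents (power_mon \<beta> js) = \<beta>"
    using js count_power_mon by (simp add: exponents_def strict_sorted_iff)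
qed

lemma sorted_support_increasing:
  assumes "0 \<notin># m"
  shows "sorted_list_of_set (set_mset m) \<in> increasing_indices (length (exponents m))"
  using assms by (auto simp: increasing_indices_def exponents_def)

lemma sum_list_exponents: "sum_list (exponents m) = size m"
  by (metis exponents_def length_map power_mon_exponents size_power_mon)

lemma partial_sums_exponents:
  "partial_sums (exponents m) = mset_breaks m"
proof -
  have "breaks (<) (run_list (exponents m) (sorted_list_of_set (set_mset m))) = partial_sums (exponents m)"
    by (rule breaks_run_list[OF _ _ composition_exponents]) (auto simp: exponents_def)
  moreover have "sorted_list_of_multiset m = run_list (exponents m) (sorted_list_of_set (set_mset m))"
    using sorted_list_of_power_mon[of "sorted_list_of_set (set_mset m)" "exponents m"]
    by (simp add: power_mon_exponents composition_exponents) (simp add: exponents_def)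
  ultimately show ?thesis by simp
qed

text \<open>A composition and its increasing indices can be recovered from the monomial, so the sum
  that defines the coefficient has at most one term.\<close>

lemma M_fun_eq:
  assumes "composition \<beta>"
  shows "M_fun \<beta> m = (if 0 \<notin># m \<and> \<beta> = exponents m then 1 else 0)"
proof -
  have "{js \<in> increasing_indices (length \<beta>). power_mon \<beta> js = m}
      = (if 0 \<notin># m \<and> \<beta> = exponents m then {sorted_list_of_set (set_mset m)} else {})"
  proof (cases "0 \<notin># m \<and> \<beta> = exponents m")
    case True
    then show ?thesis
      using sorted_support_increasing[of m] exponents_power_mon(2)[OF assms]
      by (auto simp: power_mon_exponents) metis+
  next
    case False
    have "js \<notin> increasing_indices (length \<beta>)" if "power_mon \<beta> js = m" for js
    proof
      assume js: "js \<in> increasing_indices (length \<beta>)"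
      then have "0 \<notin># m"
        using set_power_mon[of js \<beta>] assms that by (auto simp: increasing_indices_def)
      then show False
        using False exponents_power_mon[OF assms js] that by auto
    qed
    then show ?thesis using False by auto
  qed
  then show ?thesis
    by (simp add: M_fun_def formal_sum_def)
qed

lemma length_le_sum_list: "composition \<beta> \<Longrightarrow> length \<beta> \<le> sum_list \<beta>"
  by (induction \<beta>) auto

lemma finite_compositions: "finite {\<beta>. composition \<beta> \<and> sum_list \<beta> = n}"
proof (rule finite_subset)
  show "{\<beta>. composition \<beta> \<and> sum_list \<beta> = n} \<subseteq> {\<beta>. set \<beta> \<subseteq> {..n} \<and> length \<beta> \<le> n}"
    using length_le_sum_list member_le_sum_list by fastforce
  show "finite {\<beta>. set \<beta> \<subseteq> {..n} \<and> length \<beta> \<le> n}"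
    by (rule finite_lists_length_le) simp
qed

text \<open>Only the refinement \<open>exponents m\<close> contributes at \<open>m\<close>; the
  condition that it refines \<alpha> is then rewritten through the breaks of
  \<open>m\<close>.\<close>

lemma L_fun_eq:
  "L_fun \<alpha> m = (if 0 \<notin># m \<and> size m = sum_list \<alpha> \<and> partial_sums \<alpha> \<subseteq> mset_breaks m then 1 else 0)"
proof -
  have fin: "finite {\<beta>. refines \<beta> \<alpha>}"
    by (rule finite_subset[OF _ finite_compositions[of "sum_list \<alpha>"]]) (auto simp: refines_def)
  have "L_fun \<alpha> m = (\<Sum>\<beta> | refines \<beta> \<alpha>. if \<beta> = exponents m then (if 0 \<notin># m then 1 else 0) else 0)"
    unfolding L_fun_def by (intro sum.cong) (auto simp: refines_def M_fun_eq)
  also have "\<dots> = (if 0 \<notin># m \<and> refines (exponents m) \<alpha> then 1 else 0)"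
    using fin by simp
  finally show ?thesis
    by (auto simp: refines_def composition_exponents sum_list_exponents partial_sums_exponents)
qed

lemma partial_sums_pos:
  assumes "composition \<alpha>" "s \<in> partial_sums \<alpha>"
  shows "0 < s"
proof -
  obtain a \<beta> where \<alpha>: "\<alpha> = a # \<beta>" "\<beta> \<noteq> []"
    using assms(2) by (cases \<alpha>; cases "tl \<alpha>") auto
  then show ?thesis
    using assms by (auto simp: partial_sums_Cons)
qed

lemma partial_sums_eq_empty_iff: "partial_sums \<alpha> = {} \<longleftrightarrow> length \<alpha> \<le> 1"
proof
  show "partial_sums \<alpha> = {} \<Longrightarrow> length \<alpha> \<le> 1"
    by (rule ccontr) (auto simp: partial_sums_def)
qed (auto simp: partial_sums_def)

text \<open>The first part is the least partial sum, because all parts are positive. Removing it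
  shifts the remaining partial sums, and induction applies.\<close>

lemma composition_eqI:
  assumes "composition \<alpha>" "composition \<beta>" "sum_list \<alpha> = sum_list \<beta>"
    "partial_sums \<alpha> = partial_sums \<beta>"
  shows "\<alpha> = \<beta>"
  using assms
proof (induction \<alpha> arbitrary: \<beta>)
  case Nil
  then show ?case by (cases \<beta>) auto
next
  case (Cons a \<alpha>)
  obtain b \<beta>' where \<beta>: "\<beta> = b # \<beta>'"
    using Cons.prems by (cases \<beta>) auto
  show ?case
  proof (cases "\<alpha> = []")
    case True
    then have "length \<beta> \<le> 1"
      using Cons.prems partial_sums_eq_empty_iff by (metis partial_sums_simps(2))
    then show ?thesis using True \<beta> Cons.prems by simp
  next
    case False
    then have "\<not> length \<beta> \<le> 1"
      using Cons.prems partial_sums_eq_empty_iff[of "a # \<alpha>"] partial_sums_eq_empty_iff[of \<beta>]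
      by (cases \<alpha>) auto
    then have ne: "\<beta>' \<noteq> []" using \<beta> by auto
    have eq: "insert a ((+) a ` partial_sums \<alpha>) = insert b ((+) b ` partial_sums \<beta>')"
      using Cons.prems \<beta> by (simp add: partial_sums_Cons False ne)
    have "b \<in> insert a ((+) a ` partial_sums \<alpha>)" "a \<in> insert b ((+) b ` partial_sums \<beta>')"
      using eq by blast+
    then have "a \<le> b" "b \<le> a"
      by auto
    then have "a = b" by simp
    have "a \<notin> (+) a ` partial_sums \<alpha>" "a \<notin> (+) a ` partial_sums \<beta>'"
      using partial_sums_pos[of \<alpha>] partial_sums_pos[of \<beta>'] Cons.prems \<beta> by fastforce+
    then have "(+) a ` partial_sums \<alpha> = (+) a ` partial_sums \<beta>'"
      using eq \<open>a = b\<close> by (metis insert_ident)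
    then have "partial_sums \<alpha> = partial_sums \<beta>'"
      by (simp add: inj_image_eq_iff)
    then show ?thesis
      using Cons.IH[of \<beta>'] Cons.prems \<beta> \<open>a = b\<close> by auto
  qed
qed

lemma ex_composition:
  assumes "S \<subseteq> {1..<n}"
  shows "\<exists>\<beta>. composition \<beta> \<and> sum_list \<beta> = n \<and> partial_sums \<beta> = S"
proof -
  \<comment> \<open>The counting function of S increases exactly at the elements of S. Its values
    form a sorted list of length n, and the multiplicities of these values are the parts of the
    desired composition.\<close>
  define l where "l = map (\<lambda>i. card {s \<in> S. s \<le> i}) [0..<n]"
  have finS: "finite S"
    using assms finite_subset by blast
  have "sorted l"
    unfolding l_def sorted_iff_nth_mono using finS by (auto intro!: card_mono)
  then have sl: "sorted_list_of_multiset (mset l) = l"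
    by (simp add: sorted_sort_id)
  have *: "card {s \<in> S. s \<le> i} < card {s \<in> S. s \<le> Suc i} \<longleftrightarrow> Suc i \<in> S" for i
  proof -
    have "{s \<in> S. s \<le> Suc i} = (if Suc i \<in> S then insert (Suc i) {s \<in> S. s \<le> i} else {s \<in> S. s \<le> i})"
      by (auto simp: le_Suc_eq)
    then show ?thesis using finS by simp
  qed
  have "breaks (<) l = S"
  proof (intro set_eqI)
    fix s show "s \<in> breaks (<) l \<longleftrightarrow> s \<in> S"
    proof (cases s)
      case 0
      then show ?thesis using assms by (auto simp: breaks_def)
    next
      case (Suc i)
      then show ?thesis using assms * by (auto simp: Suc_mem_breaks_iff l_def)
    qed
  qed
  then show ?thesis
    using composition_exponents[of "mset l"] sum_list_exponents[of "mset l"]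
      partial_sums_exponents[of "mset l"] sl by (auto simp: l_def)
qed

definition composition_of :: "nat \<Rightarrow> nat set \<Rightarrow> nat list" where
  "composition_of n S = (THE \<beta>. composition \<beta> \<and> sum_list \<beta> = n \<and> partial_sums \<beta> = S)"

lemma composition_of:
  assumes "S \<subseteq> {1..<n}"
  shows "composition (composition_of n S)" "sum_list (composition_of n S) = n"
    "partial_sums (composition_of n S) = S"
proof -
  have "\<exists>!\<beta>. composition \<beta> \<and> sum_list \<beta> = n \<and> partial_sums \<beta> = S"
    using ex_composition[OF assms] composition_eqI by (metis (full_types))
  from theI'[OF this]
  show "composition (composition_of n S)" "sum_list (composition_of n S) = n"
    "partial_sums (composition_of n S) = S"
    unfolding composition_of_def by auto
qed

lemma comp_complement_composition_of:
  assumes "S \<subseteq> {1..<n}"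
  shows "comp_complement (composition_of n S) = composition_of n ({1..<n} - S)"
  unfolding comp_complement_def composition_of(2,3)[OF assms]
  by (simp only: composition_of_def)

lemma L_fun_composition_of:
  assumes "S \<subseteq> {1..<n}"
  shows "L_fun (composition_of n S) m = (if 0 \<notin># m \<and> size m = n \<and> S \<subseteq> mset_breaks m then 1 else 0)"
  by (simp add: L_fun_eq composition_of[OF assms])

section \<open>Linear independence of the fundamental quasisymmetric functions\<close>

text \<open>The monomial with exponents \<beta> in the first variables is a test point for
  M_\<beta>. At these points the L_\<alpha> form the incidence matrix of refinement.\<close>

lemma L_fun_power_mon_upt:
  assumes "composition \<alpha>" "composition \<beta>"
  shows "L_fun \<alpha> (power_mon \<beta> [1..<Suc (length \<beta>)]) = (if refines \<beta> \<alpha> then 1 else 0)"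
proof -
  define js where "js = [1..<Suc (length \<beta>)]"
  have js: "js \<in> increasing_indices (length \<beta>)" "length js = length \<beta>" "0 \<notin> set js"
    by (simp_all add: increasing_indices_def js_def del: upt_Suc)
  then have "0 \<notin># power_mon \<beta> js"
    using assms by (simp add: set_power_mon)
  then show ?thesis
    using mset_breaks_power_mon[OF js(1)] size_power_mon[OF js(2)] assms
    unfolding js_def[symmetric] by (auto simp: L_fun_eq refines_def)
qed

lemma card_partial_sums:
  assumes "composition \<alpha>"
  shows "card (partial_sums \<alpha>) = length \<alpha> - 1"
  using assms
proof (induction \<alpha>)
  case (Cons a \<alpha>)
  show ?case
  proof (cases "\<alpha> = []")
    case False
    have "a \<notin> (+) a ` partial_sums \<alpha>"
      using partial_sums_pos[of \<alpha>] Cons.prems by fastforce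
    moreover have "finite (partial_sums \<alpha>)"
      by (simp add: partial_sums_def)
    ultimately show ?thesis
      using Cons False by (simp add: partial_sums_Cons card_image)
  qed simp
qed simp

lemma refines_imp_eq_or_length_less:
  assumes "refines \<beta> \<alpha>" "composition \<alpha>" "\<alpha> \<noteq> \<beta>"
  shows "length \<alpha> < length \<beta>"
proof -
  have "partial_sums \<alpha> \<subset> partial_sums \<beta>"
    using assms composition_eqI by (auto simp: refines_def)
  moreover have "finite (partial_sums \<beta>)"
    by (simp add: partial_sums_def)
  ultimately have "card (partial_sums \<alpha>) < card (partial_sums \<beta>)"
    by (rule psubset_card_mono[rotated])
  then show ?thesis
    using assms by (simp add: card_partial_sums refines_def)
qed

text \<open>The refinement matrix is triangular: a composition properly refined by \<alpha> has
  fewer parts than \<alpha>. Induction on the number of parts leaves only the diagonal term at the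
  test monomial of \<alpha>.\<close>

lemma L_fun_independent:
  fixes d :: "nat list \<Rightarrow> int"
  assumes fin: "finite A" and comp: "\<And>\<alpha>. \<alpha> \<in> A \<Longrightarrow> composition \<alpha>"
    and zero: "\<And>m. (\<Sum>\<alpha>\<in>A. d \<alpha> * L_fun \<alpha> m) = 0"
    and "\<alpha> \<in> A"
  shows "d \<alpha> = 0"
  using assms(4)
proof (induction "length \<alpha>" arbitrary: \<alpha> rule: less_induct)
  case less
  have "0 = (\<Sum>\<beta>\<in>A. d \<beta> * L_fun \<beta> (power_mon \<alpha> [1..<Suc (length \<alpha>)]))"
    using zero by simp
  also have "\<dots> = (\<Sum>\<beta>\<in>A. if \<beta> = \<alpha> then d \<beta> else 0)"
  proof (intro sum.cong refl)
    fix \<beta> assume \<beta>: "\<beta> \<in> A"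
    have "refines \<alpha> \<alpha>"
      using comp less.prems by (simp add: refines_def)
    moreover have "d \<beta> = 0" if "refines \<alpha> \<beta>" "\<beta> \<noteq> \<alpha>"
      using less.hyps[OF refines_imp_eq_or_length_less] that \<beta> comp by blast
    ultimately show "d \<beta> * L_fun \<beta> (power_mon \<alpha> [1..<Suc (length \<alpha>)]) = (if \<beta> = \<alpha> then d \<beta> else 0)"
      unfolding L_fun_power_mon_upt[OF comp[OF \<beta>] comp[OF less.prems]] by auto
  qed
  finally show ?case
    using fin less.prems by simp
qed

lemma L_expansion_unique:
  assumes "L_expansion F c" "L_expansion F c'"
  shows "c = c'"
proof
  fix \<alpha>
  let ?A = "{\<alpha>. c \<alpha> \<noteq> 0} \<union> {\<alpha>. c' \<alpha> \<noteq> 0}"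
  have fin: "finite ?A"
    using assms by (simp add: L_expansion_def)
  have "(\<Sum>\<alpha>\<in>?A. (c \<alpha> - c' \<alpha>) * L_fun \<alpha> m) = 0" for m
  proof -
    have "(\<Sum>\<alpha>\<in>?A. c \<alpha> * L_fun \<alpha> m) = (\<Sum>\<alpha> | c \<alpha> \<noteq> 0. c \<alpha> * L_fun \<alpha> m)"
      by (rule sum.mono_neutral_right[OF fin]) auto
    moreover have "(\<Sum>\<alpha>\<in>?A. c' \<alpha> * L_fun \<alpha> m) = (\<Sum>\<alpha> | c' \<alpha> \<noteq> 0. c' \<alpha> * L_fun \<alpha> m)"
      by (rule sum.mono_neutral_right[OF fin]) auto
    moreover have "F m = (\<Sum>\<alpha> | c \<alpha> \<noteq> 0. c \<alpha> * L_fun \<alpha> m)" "F m = (\<Sum>\<alpha> | c' \<alpha> \<noteq> 0. c' \<alpha> * L_fun \<alpha> m)"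
      using assms unfolding L_expansion_def by metis+
    ultimately show ?thesis
      by (simp add: left_diff_distrib sum_subtractf)
  qed
  moreover have "composition \<beta>" if "\<beta> \<in> ?A" for \<beta>
    using that assms by (auto simp: L_expansion_def)
  ultimately have "c \<alpha> - c' \<alpha> = 0" if "\<alpha> \<in> ?A"
    using L_fun_independent[OF fin, of "\<lambda>\<alpha>. c \<alpha> - c' \<alpha>"] that by blast
  then show "c \<alpha> = c' \<alpha>"
    by (cases "\<alpha> \<in> ?A") auto
qed

subsection \<open>Partitions of labelled posets\<close>

definition linear_extensions :: "'p::finite rel \<Rightarrow> 'p list set" where
  "linear_extensions P = {xs \<in> permutations_of_set UNIV. sorted_wrt (\<lambda>x y. (y, x) \<notin> P) xs}"

abbreviation descents :: "('p \<Rightarrow> nat) \<Rightarrow> 'p list \<Rightarrow> nat set" where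
  "descents \<gamma> xs \<equiv> breaks (\<lambda>x y. \<gamma> y < \<gamma> x) xs"

abbreviation standardized :: "('p \<Rightarrow> nat) \<Rightarrow> ('p \<Rightarrow> nat) \<Rightarrow> 'p list \<Rightarrow> bool" where
  "standardized \<gamma> f xs \<equiv> sorted_wrt (\<lambda>x y. f x < f y \<or> f x = f y \<and> \<gamma> x < \<gamma> y) xs"

lemma finite_linear_extensions [simp]: "finite (linear_extensions P)"
  by (simp add: linear_extensions_def)

lemma length_permutation:
  assumes "xs \<in> permutations_of_set (UNIV :: 'p::finite set)"
  shows "length xs = CARD('p)" "set xs = UNIV" "distinct xs"
  using assms length_finite_permutations_of_set
  by (auto simp: permutations_of_set_def)

lemma x_mon_eq_mset_map:
  assumes "xs \<in> permutations_of_set (UNIV :: 'p::finite set)"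
  shows "x_mon f = mset (map f xs)"
proof -
  have "x_mon f = (\<Sum>p\<leftarrow>xs. {#f p#})"
    using length_permutation[OF assms] sum_list_distinct_conv_sum_set[of xs "\<lambda>p. {#f p#}"]
    unfolding x_mon_def by metis
  also have "\<dots> = mset (map f xs)"
    by (induction xs) auto
  finally show ?thesis .
qed

text \<open>The lexicographic comparison by f and then \<gamma> is encoded in one injective
  numerical key, with a base \<open>N\<close> that exceeds all labels. Existence is then sorting by
  the key, and uniqueness is that of a strictly sorted list.\<close>

lemma ex1_standardized:
  fixes \<gamma> f :: "'p::finite \<Rightarrow> nat"
  assumes "inj \<gamma>"
  shows "\<exists>!xs. xs \<in> permutations_of_set UNIV \<and> standardized \<gamma> f xs"
proof -
  define N where "N = Suc (Max (range \<gamma>))"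
  have N: "\<gamma> x < N" for x
    by (simp add: N_def less_Suc_eq_le)
  define key where "key x = f x * N + \<gamma> x" for x
  have key_less: "key x < key y \<longleftrightarrow> f x < f y \<or> f x = f y \<and> \<gamma> x < \<gamma> y" for x y
  proof -
    have *: "key x < key y" if "f x < f y" for x y
    proof -
      have "f x * N + N \<le> f y * N"
        using that by (metis Suc_leI mult_Suc mult_le_mono1 add.commute)
      then show ?thesis using N[of x] by (simp add: key_def)
    qed
    show ?thesis
      using *[of x y] *[of y x] by (cases "f x" "f y" rule: linorder_cases) (auto simp: key_def)
  qed
  have inj: "inj key"
  proof (rule injI)
    fix x y assume "key x = key y"
    then have "\<gamma> x = \<gamma> y"
      using key_less[of x y] key_less[of y x] by (metis less_irrefl nat_neq_iff)
    then show "x = y" using assms by (simp add: inj_eq)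
  qed
  have std: "standardized \<gamma> f xs \<longleftrightarrow> sorted_wrt (<) (map key xs)" for xs
    by (simp add: sorted_wrt_map key_less)
  show ?thesis
  proof (intro ex_ex1I)
    obtain ys where ys: "set ys = (UNIV :: 'p set)" "distinct ys"
      using finite_distinct_list[OF finite] by blast
    have "sorted (map key (sort_key key ys))" "distinct (map key (sort_key key ys))"
      using ys inj by (auto simp: distinct_map intro: inj_on_subset)
    then have "sorted_wrt (<) (map key (sort_key key ys))"
      by (simp add: strict_sorted_iff)
    then show "\<exists>xs. xs \<in> permutations_of_set UNIV \<and> standardized \<gamma> f xs"
      using ys by (intro exI[of _ "sort_key key ys"]) (auto simp: std permutations_of_set_def)
  next
    fix xs ys
    assume "xs \<in> permutations_of_set UNIV \<and> standardized \<gamma> f xs"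
      "ys \<in> permutations_of_set UNIV \<and> standardized \<gamma> f ys"
    then have "map key xs = map key ys"
      by (intro sorted_distinct_set_unique)
        (auto simp: std strict_sorted_iff permutations_of_set_def)
    then show "xs = ys"
      using inj by (simp add: inj_map_eq_map)
  qed
qed

text \<open>For p \<noteq> q the two conditions on f at a relation (p, q) say together that p
  precedes q lexicographically by f and then \<gamma>, which is the order in which \<open>xs\<close>
  lists the elements.\<close>

lemma P_partition_iff_linear_extension:
  fixes P :: "'p::finite rel"
  assumes "inj \<gamma>" "xs \<in> permutations_of_set UNIV" "standardized \<gamma> f xs" "f \<in> pos_maps"
  shows "f \<in> P_partitions P \<gamma> \<longleftrightarrow> xs \<in> linear_extensions P"
proof
  assume f: "f \<in> P_partitions P \<gamma>"
  have "(y, x) \<notin> P" if "f x < f y \<or> f x = f y \<and> \<gamma> x < \<gamma> y" for x y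
  proof
    assume "(y, x) \<in> P"
    then have "f y \<le> f x \<and> (\<gamma> x < \<gamma> y \<longrightarrow> f y < f x)"
      using f by (simp add: P_partitions_def)
    then show False using that by linarith
  qed
  then have "sorted_wrt (\<lambda>x y. (y, x) \<notin> P) xs"
    using assms(3) by (auto elim: sorted_wrt_mono_rel[rotated])
  then show "xs \<in> linear_extensions P"
    using assms(2) by (simp add: linear_extensions_def)
next
  assume xs: "xs \<in> linear_extensions P"
  have "f p \<le> f q \<and> (\<gamma> q < \<gamma> p \<longrightarrow> f p < f q)" if pq: "(p, q) \<in> P" for p q
  proof (cases "p = q")
    case False
    obtain i j where ij: "i < length xs" "j < length xs" "p = xs ! i" "q = xs ! j"
      using length_permutation(2)[OF assms(2)] by (metis UNIV_I in_set_conv_nth)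
    have "\<not> j < i"
      using xs pq ij by (auto simp: linear_extensions_def sorted_wrt_iff_nth_less)
    then have "i < j"
      using False ij by (metis linorder_neqE_nat)
    then show ?thesis
      using sorted_wrt_nth_less[OF assms(3) \<open>i < j\<close> ij(2)] ij by auto
  qed simp
  then show "f \<in> P_partitions P \<gamma>"
    using assms(4) by (auto simp: P_partitions_def)
qed

text \<open>By transitivity only neighbours matter. Their labels differ: at a descent f has to
  increase strictly, elsewhere it may stay constant.\<close>

lemma standardized_iff_descents:
  assumes "inj \<gamma>" "distinct xs"
  shows "standardized \<gamma> f xs \<longleftrightarrow> sorted (map f xs) \<and> descents \<gamma> xs \<subseteq> breaks (<) (map f xs)"
proof -
  have "standardized \<gamma> f xs \<longleftrightarrow> (\<forall>i. Suc i < length xs \<longrightarrow>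
      f (xs ! i) < f (xs ! Suc i) \<or> f (xs ! i) = f (xs ! Suc i) \<and> \<gamma> (xs ! i) < \<gamma> (xs ! Suc i))"
    by (subst sorted_wrt_iff_nth_Suc_transp) (auto intro!: transpI)
  also have "\<dots> \<longleftrightarrow> (\<forall>i. Suc i < length xs \<longrightarrow>
      f (xs ! i) \<le> f (xs ! Suc i) \<and>
      (\<gamma> (xs ! Suc i) < \<gamma> (xs ! i) \<longrightarrow> f (xs ! i) < f (xs ! Suc i)))"
  proof -
    have "\<gamma> (xs ! i) \<noteq> \<gamma> (xs ! Suc i)" if "Suc i < length xs" for i
      using assms that by (auto simp: inj_eq nth_eq_iff_index_eq)
    then show ?thesis
      by (intro all_cong) (auto simp: nat_neq_iff)
  qed
  also have "\<dots> \<longleftrightarrow> sorted (map f xs) \<and> descents \<gamma> xs \<subseteq> breaks (<) (map f xs)"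
    by (auto simp: sorted_iff_nth_Suc breaks_def)
  finally show ?thesis .
qed

text \<open>Such an f is determined by \<open>map f xs\<close>, which has to be the sorted list of
  \<open>m\<close>; the condition on descents decides whether this one candidate qualifies.\<close>

lemma card_standardized:
  fixes \<gamma> :: "'p::finite \<Rightarrow> nat"
  assumes "inj \<gamma>" and xs: "xs \<in> permutations_of_set UNIV"
  shows "card {f \<in> pos_maps. standardized \<gamma> f xs \<and> x_mon f = m}
    = (if 0 \<notin># m \<and> size m = CARD('p) \<and> descents \<gamma> xs \<subseteq> mset_breaks m then 1 else 0)"
proof -
  note xs' = length_permutation[OF xs]
  have iff: "f \<in> pos_maps \<and> standardized \<gamma> f xs \<and> x_mon f = m \<longleftrightarrow>
      0 \<notin># m \<and> descents \<gamma> xs \<subseteq> mset_breaks m \<and> map f xs = sorted_list_of_multiset m" for f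
  proof -
    have "sorted (map f xs) \<and> mset (map f xs) = m \<longleftrightarrow> map f xs = sorted_list_of_multiset m"
      by (metis mset_sorted_list_of_multiset sorted_list_of_multiset_mset
          sorted_sorted_list_of_multiset sorted_sort_id)
    moreover have "f \<in> pos_maps \<longleftrightarrow> 0 \<notin># mset (map f xs)"
      using xs' by (auto simp: pos_maps_def Suc_le_eq image_iff)
    ultimately show ?thesis
      unfolding x_mon_eq_mset_map[OF xs] standardized_iff_descents[OF assms(1) xs'(3)]
      by (cases "map f xs = sorted_list_of_multiset m") (simp, blast)
  qed
  show ?thesis
  proof (cases "0 \<notin># m \<and> size m = CARD('p) \<and> descents \<gamma> xs \<subseteq> mset_breaks m")
    case True
    let ?l = "sorted_list_of_multiset m"
    have len: "length ?l = length xs"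
      using True xs' by (metis mset_sorted_list_of_multiset size_mset)
    define f where "f p = the (map_of (zip xs ?l) p)" for p
    have "map f xs = ?l"
      using len xs'(3) by (simp add: list_eq_iff_nth_eq f_def map_of_zip_nth)
    moreover have "g = f" if "map g xs = ?l" for g
    proof
      fix p
      show "g p = f p"
        using that \<open>map f xs = ?l\<close> xs'(2) by (metis UNIV_I map_eq_conv)
    qed
    ultimately have "{f \<in> pos_maps. standardized \<gamma> f xs \<and> x_mon f = m} = {f}"
      using True unfolding iff by blast
    then show ?thesis
      using True by simp
  next
    case False
    have "size m = CARD('p)" if "map f xs = sorted_list_of_multiset m" for f :: "'p \<Rightarrow> nat"
      using that xs' by (metis length_map mset_sorted_list_of_multiset size_mset)
    then have empty: "{f \<in> pos_maps. standardized \<gamma> f xs \<and> x_mon f = m} = {}"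
      using False unfolding iff by auto
    show ?thesis
      unfolding empty using False by auto
  qed
qed

lemma finite_x_mon: "finite {f. x_mon f = m}"
proof (rule finite_subset)
  show "{f. x_mon f = m} \<subseteq> (UNIV :: 'p::finite set) \<rightarrow>\<^sub>E set_mset m"
  proof clarify
    fix f :: "'p \<Rightarrow> nat"
    have "f p \<in># x_mon f" for p
      by (auto simp: x_mon_def set_mset_sum)
    then show "f \<in> UNIV \<rightarrow>\<^sub>E set_mset (x_mon f)"
      by auto
  qed
qed (simp add: finite_PiE)

text \<open>Stanley's fundamental lemma: the \<open>(P, \<gamma>)\<close>-partitions are sorted by their standardization.\<close>

lemma F_poset_eq_sum_linear_extensions:
  fixes P :: "'p::finite rel"
  assumes "inj \<gamma>"
  shows "F_poset P \<gamma> m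
    = (\<Sum>xs\<in>linear_extensions P. L_fun (composition_of CARD('p) (descents \<gamma> xs)) m)"
proof -
  let ?A = "\<lambda>xs. {f \<in> pos_maps. standardized \<gamma> f xs \<and> x_mon f = m}"
  have "{f \<in> P_partitions P \<gamma>. x_mon f = m} = (\<Union>xs\<in>linear_extensions P. ?A xs)"
  proof (intro set_eqI iffI)
    fix f assume f: "f \<in> {f \<in> P_partitions P \<gamma>. x_mon f = m}"
    obtain xs where xs: "xs \<in> permutations_of_set UNIV" "standardized \<gamma> f xs"
      using ex1_standardized[OF assms, of f] by auto
    have "f \<in> pos_maps"
      using f by (auto simp: P_partitions_def)
    then have "xs \<in> linear_extensions P"
      using P_partition_iff_linear_extension[OF assms xs] f by auto
    then show "f \<in> (\<Union>xs\<in>linear_extensions P. ?A xs)"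
      using xs f \<open>f \<in> pos_maps\<close> by auto
  next
    fix f assume "f \<in> (\<Union>xs\<in>linear_extensions P. ?A xs)"
    then obtain xs where "xs \<in> linear_extensions P" "f \<in> ?A xs"
      by auto
    then show "f \<in> {f \<in> P_partitions P \<gamma>. x_mon f = m}"
      using P_partition_iff_linear_extension[OF assms, of xs f P]
      by (auto simp: linear_extensions_def)
  qed
  then have "F_poset P \<gamma> m = int (card (\<Union>xs\<in>linear_extensions P. ?A xs))"
    by (simp add: F_poset_def formal_sum_def)
  also have "card (\<Union>xs\<in>linear_extensions P. ?A xs) = (\<Sum>xs\<in>linear_extensions P. card (?A xs))"
  proof (rule card_UN_disjoint)
    show "\<forall>xs\<in>linear_extensions P. finite (?A xs)"
      by (intro ballI finite_subset[OF _ finite_x_mon[of m]]) auto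
    show "\<forall>xs\<in>linear_extensions P. \<forall>ys\<in>linear_extensions P. xs \<noteq> ys \<longrightarrow> ?A xs \<inter> ?A ys = {}"
    proof (intro ballI impI equals0I)
      fix xs ys f
      assume "xs \<in> linear_extensions P" "ys \<in> linear_extensions P" "xs \<noteq> ys" "f \<in> ?A xs \<inter> ?A ys"
      then show False
        using ex1_standardized[OF assms, of f] by (auto simp: linear_extensions_def)
    qed
  qed simp
  also have "int \<dots> = (\<Sum>xs\<in>linear_extensions P. L_fun (composition_of CARD('p) (descents \<gamma> xs)) m)"
    unfolding of_nat_sum
  proof (intro sum.cong refl)
    fix xs assume "xs \<in> linear_extensions P"
    then have xs: "xs \<in> permutations_of_set UNIV"
      by (simp add: linear_extensions_def)
    then have "descents \<gamma> xs \<subseteq> {1..<CARD('p)}"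
      using breaks_subset length_permutation by metis
    then show "int (card (?A xs)) = L_fun (composition_of CARD('p) (descents \<gamma> xs)) m"
      using card_standardized[OF assms xs, of m] by (simp add: L_fun_composition_of)
  qed
  finally show ?thesis .
qed

section \<open>Strict labellings and their reversals\<close>

lemma strict_P_partitions:
  assumes "strictly_labelled_poset P \<gamma>"
  shows "P_partitions P \<gamma> = {f \<in> pos_maps. \<forall>p q. (p, q) \<in> P \<and> p \<noteq> q \<longrightarrow> f p < f q}"
  using assms by (fastforce simp: P_partitions_def strictly_labelled_poset_def)

text \<open>On a labelling with range [n] the values are 0 to n - 1, so the result is no labelling
  in the sense of \<open>labelled_poset\<close>. The lemmas on standardization ask for an injective
  map only.\<close>

definition reverse_labels :: "('p::finite \<Rightarrow> nat) \<Rightarrow> 'p \<Rightarrow> nat" where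
  "reverse_labels \<gamma> p = CARD('p) - \<gamma> p"

lemma reverse_labels_less_iff:
  fixes \<gamma> :: "'p::finite \<Rightarrow> nat"
  assumes "labelled_poset P \<gamma>"
  shows "reverse_labels \<gamma> p < reverse_labels \<gamma> q \<longleftrightarrow> \<gamma> q < \<gamma> p"
proof -
  have "\<gamma> p \<le> CARD('p)" for p
    using assms bij_betwE by (fastforce simp: labelled_poset_def)
  from this[of p] this[of q] show ?thesis
    unfolding reverse_labels_def by auto
qed

lemma inj_labels:
  assumes "labelled_poset P \<gamma>"
  shows "inj \<gamma>" "inj (reverse_labels \<gamma>)"
proof -
  show "inj \<gamma>"
    using assms by (simp add: labelled_poset_def bij_betw_def)
  then show "inj (reverse_labels \<gamma>)"
    using reverse_labels_less_iff[OF assms] unfolding inj_def by (metis nat_neq_iff)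
qed

text \<open>Reversed labels increase along P, so no relation demands a strict inequality.\<close>

lemma weak_P_partitions:
  assumes "strictly_labelled_poset P \<gamma>"
  shows "P_partitions P (reverse_labels \<gamma>) = {f \<in> pos_maps. \<forall>p q. (p, q) \<in> P \<longrightarrow> f p \<le> f q}"
proof -
  have "labelled_poset P \<gamma>"
    using assms by (simp add: strictly_labelled_poset_def)
  moreover have "\<not> \<gamma> p < \<gamma> q" if "(p, q) \<in> P" for p q
    using that assms by (metis less_asym less_irrefl strictly_labelled_poset_def)
  ultimately show ?thesis
    by (auto simp: P_partitions_def reverse_labels_less_iff)
qed

lemma descents_reverse_labels:
  fixes \<gamma> :: "'p::finite \<Rightarrow> nat"
  assumes "labelled_poset P \<gamma>" "xs \<in> permutations_of_set UNIV"
  shows "descents (reverse_labels \<gamma>) xs = {1..<CARD('p)} - descents \<gamma> xs"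
proof -
  note xs = length_permutation[OF assms(2)]
  have "\<gamma> (xs ! i) < \<gamma> (xs ! Suc i) \<longleftrightarrow> \<not> \<gamma> (xs ! Suc i) < \<gamma> (xs ! i)" if "Suc i < length xs" for i
  proof -
    have "xs ! i \<noteq> xs ! Suc i"
      using that xs(3) by (simp add: nth_eq_iff_index_eq)
    then have "\<gamma> (xs ! i) \<noteq> \<gamma> (xs ! Suc i)"
      by (simp add: inj_eq[OF inj_labels(1)[OF assms(1)]])
    then show ?thesis by linarith
  qed
  then have "Suc i \<in> descents (reverse_labels \<gamma>) xs \<longleftrightarrow> Suc i \<in> {1..<CARD('p)} - descents \<gamma> xs" for i
    unfolding Suc_mem_breaks_iff reverse_labels_less_iff[OF assms(1)] Diff_iff using xs(1) by auto
  moreover have "0 \<notin> descents (reverse_labels \<gamma>) xs"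
    by (simp add: breaks_def)
  ultimately have "i \<in> descents (reverse_labels \<gamma>) xs \<longleftrightarrow> i \<in> {1..<CARD('p)} - descents \<gamma> xs" for i
    by (cases i) (simp, metis)
  then show ?thesis by blast
qed

lemma ex_strict_labelling:
  fixes P :: "'p::finite rel"
  assumes "partial_order_on UNIV P"
  shows "\<exists>\<gamma>. strictly_labelled_poset P \<gamma>"
proof -
  obtain e :: "'p \<Rightarrow> nat" where e: "bij_betw e UNIV {0..<CARD('p)}"
    using ex_bij_betw_finite_nat[OF finite] by auto
  have e_less: "e p < CARD('p)" for p
    using e bij_betwE by fastforce
  \<comment> \<open>The size of the down-set grows strictly along P, and the enumeration
    \<open>e\<close> breaks ties as the last digit in base n. So \<open>h\<close> is injective and
    strictly increasing along P.\<close>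
  define h where "h p = card {q. (q, p) \<in> P} * CARD('p) + e p" for p
  have inj_h: "inj h"
  proof (rule injI)
    fix p q assume "h p = h q"
    then have "h p mod CARD('p) = h q mod CARD('p)"
      by simp
    then have "e p = e q"
      using e_less by (simp add: h_def)
    then show "p = q"
      using e by (auto simp: bij_betw_def inj_eq)
  qed
  have mono_h: "h p < h q" if pq: "(p, q) \<in> P" "p \<noteq> q" for p q
  proof -
    have P: "refl P" "trans P" "antisym P"
      using assms by (auto simp: partial_order_on_def preorder_on_def)
    have "{r. (r, p) \<in> P} \<subset> {r. (r, q) \<in> P}"
    proof
      show "{r. (r, p) \<in> P} \<subseteq> {r. (r, q) \<in> P}"
        using P pq by (auto dest: transD)
      show "{r. (r, p) \<in> P} \<noteq> {r. (r, q) \<in> P}"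
        using P pq by (metis antisymD mem_Collect_eq reflD)
    qed
    then have "card {r. (r, p) \<in> P} < card {r. (r, q) \<in> P}"
      by (intro psubset_card_mono) auto
    then have "card {r. (r, p) \<in> P} * CARD('p) + CARD('p) \<le> card {r. (r, q) \<in> P} * CARD('p)"
      by (metis Suc_leI mult_Suc mult_le_mono1 add.commute)
    then show ?thesis
      using e_less[of p] by (simp add: h_def)
  qed
  \<comment> \<open>The rank counted from the top of \<open>h\<close>: this reverses the order, as a
    strict labelling demands, and compresses the values to [n].\<close>
  define \<gamma> where "\<gamma> p = card {q. h p \<le> h q}" for p
  have anti: "\<gamma> q < \<gamma> p" if "h p < h q" for p q
    unfolding \<gamma>_def using that by (intro psubset_card_mono) force+
  have "inj \<gamma>"
    using anti inj_h unfolding inj_def by (metis nat_neq_iff)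
  moreover have "\<gamma> ` UNIV \<subseteq> {1..CARD('p)}"
    by (auto simp: \<gamma>_def card_mono Suc_le_eq card_gt_0_iff)
  ultimately have "bij_betw \<gamma> UNIV {1..CARD('p)}"
    by (metis bij_betw_def card_image card_subset_eq finite_atLeastAtMost card_atLeastAtMost diff_Suc_1)
  then show ?thesis
    using assms anti mono_h by (auto simp: strictly_labelled_poset_def labelled_poset_def)
qed

text \<open>If every position is a descent, the labels decrease along the list, which leaves one
  permutation: the standardization of a constant map under the reversed labels. Strictness of the
  labelling makes it a linear extension. Hence each vertex contributes exactly 1 to the coefficient
  of L_(1,...,1).\<close>

lemma card_full_descents:
  fixes P :: "'p::finite rel"
  assumes "strictly_labelled_poset P \<gamma>"
  shows "card {xs \<in> linear_extensions P. descents \<gamma> xs = {1..<CARD('p)}} = 1"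
proof -
  have lab: "labelled_poset P \<gamma>"
    using assms by (simp add: strictly_labelled_poset_def)
  have iff: "xs \<in> linear_extensions P \<and> descents \<gamma> xs = {1..<CARD('p)} \<longleftrightarrow>
      xs \<in> permutations_of_set UNIV \<and> standardized (reverse_labels \<gamma>) (\<lambda>_. 0) xs" for xs
  proof
    assume l: "xs \<in> linear_extensions P \<and> descents \<gamma> xs = {1..<CARD('p)}"
    then have xs: "xs \<in> permutations_of_set UNIV"
      by (simp add: linear_extensions_def)
    have "descents (reverse_labels \<gamma>) xs = {}"
      using descents_reverse_labels[OF lab xs] l by simp
    then show "xs \<in> permutations_of_set UNIV \<and> standardized (reverse_labels \<gamma>) (\<lambda>_. 0) xs"
      using standardized_iff_descents[OF inj_labels(2)[OF lab] length_permutation(3)[OF xs], of "\<lambda>_. 0"] xs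
      by (simp add: map_replicate_const)
  next
    assume r: "xs \<in> permutations_of_set UNIV \<and> standardized (reverse_labels \<gamma>) (\<lambda>_. 0) xs"
    then have xs: "xs \<in> permutations_of_set UNIV" by simp
    have less: "sorted_wrt (\<lambda>x y. \<gamma> y < \<gamma> x) xs"
      using r by (simp add: reverse_labels_less_iff[OF lab])
    have "descents (reverse_labels \<gamma>) xs = {}"
      using r standardized_iff_descents[OF inj_labels(2)[OF lab] length_permutation(3)[OF xs], of "\<lambda>_. 0"]
      by (simp add: map_replicate_const)
    then have "{1..<CARD('p)} \<subseteq> descents \<gamma> xs"
      using descents_reverse_labels[OF lab xs] by auto
    then have "descents \<gamma> xs = {1..<CARD('p)}"
      using breaks_subset[of _ xs] length_permutation(1)[OF xs] by (metis subset_antisym)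
    moreover have "sorted_wrt (\<lambda>x y. (y, x) \<notin> P) xs"
      using assms by (intro sorted_wrt_mono_rel[OF _ less])
        (metis less_not_sym less_irrefl strictly_labelled_poset_def)
    ultimately show "xs \<in> linear_extensions P \<and> descents \<gamma> xs = {1..<CARD('p)}"
      using xs by (simp add: linear_extensions_def)
  qed
  obtain xs where "{xs \<in> linear_extensions P. descents \<gamma> xs = {1..<CARD('p)}} = {xs}"
    using ex1_standardized[OF inj_labels(2)[OF lab], of "\<lambda>_. 0"] unfolding iff by blast
  then show ?thesis by simp
qed

subsection \<open>Vertices and edges of generalized permutohedra\<close>

lemma ex_extreme_minimizer:
  fixes S :: "'a::euclidean_space set"
  assumes "compact S" "convex S" "S \<noteq> {}"
  obtains u where "u extreme_point_of S" "\<And>x. x \<in> S \<Longrightarrow> a \<bullet> u \<le> a \<bullet> x"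
proof -
  have "continuous_on S (\<lambda>x. a \<bullet> x)"
    by (intro continuous_intros)
  then obtain y where y: "y \<in> S" "\<And>x. x \<in> S \<Longrightarrow> a \<bullet> y \<le> a \<bullet> x"
    using continuous_attains_inf[OF assms(1,3), of "\<lambda>x. a \<bullet> x"] by blast
  define F where "F = S \<inter> {x. a \<bullet> x = a \<bullet> y}"
  have F: "F face_of S"
    unfolding F_def using assms(2) y by (intro face_of_Int_supporting_hyperplane_ge) auto
  then have "compact F" "convex F"
    using assms face_of_imp_compact face_of_imp_convex by blast+
  moreover have "F \<noteq> {}"
    using y by (auto simp: F_def)
  ultimately obtain u where u: "u extreme_point_of F"
    using extreme_point_exists_convex by blast
  then have "u \<in> F"
    by (simp add: extreme_point_of_def)
  show ?thesis
  proof
    show "u extreme_point_of S"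
      using u F extreme_point_of_face by blast
    show "a \<bullet> u \<le> a \<bullet> x" if "x \<in> S" for x
      using \<open>u \<in> F\<close> y(2)[OF that] by (simp add: F_def)
  qed
qed

lemma polytope_eq_hull_extreme_points:
  fixes S :: "'a::euclidean_space set"
  assumes "polytope S"
  shows "S = convex hull {x. x extreme_point_of S}"
  using assms Krein_Milman_Minkowski polytope_imp_compact polytope_imp_convex by blast

lemma finite_extreme_points:
  fixes S :: "'a::euclidean_space set"
  assumes "polytope S"
  shows "finite {x. x extreme_point_of S}"
  using assms finite_polyhedron_extreme_points polytope_imp_polyhedron by blast

text \<open>As v is extreme, Q without v is still convex and so contains the hull of the other
  extreme points. This hull is compact and misses v, so it can be separated from v strictly.\<close>

lemma ex_hyperplane_cutting_vertex:
  fixes Q :: "'a::euclidean_space set"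
  assumes "polytope Q" "v extreme_point_of Q"
  obtains g c where "g \<bullet> v < c" "\<And>u. u extreme_point_of Q \<Longrightarrow> u \<noteq> v \<Longrightarrow> c < g \<bullet> u"
proof -
  define K where "K = convex hull ({x. x extreme_point_of Q} - {v})"
  have "convex (Q - {v})"
    using assms extreme_point_of_stillconvex polytope_imp_convex by blast
  then have "K \<subseteq> Q - {v}"
    unfolding K_def by (intro hull_minimal) (auto simp: extreme_point_of_def)
  moreover have "closed K"
    unfolding K_def using finite_extreme_points[OF assms(1)]
    by (intro compact_imp_closed finite_imp_compact_convex_hull) auto
  ultimately obtain g c where "g \<bullet> v < c" "\<forall>x\<in>K. c < g \<bullet> x"
    using separating_hyperplane_closed_point[of K v] by (auto simp: K_def)
  moreover have "u \<in> K" if "u extreme_point_of Q" "u \<noteq> v" for u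
    unfolding K_def using that by (intro hull_inc) auto
  ultimately show ?thesis
    using that by blast
qed

text \<open>The point x lies on a segment from v to some z in the hull of the other vertices, beyond
  the hyperplane. The segment crosses the hyperplane at the desired y. Along it the functional a is
  affine, so its change from v has the same sign at x, z and y.\<close>

lemma ex_point_on_cutting_hyperplane:
  fixes S :: "'a::euclidean_space set"
  assumes S: "polytope S" "v \<in> S" and v: "g \<bullet> v < c"
    and others: "\<And>u. u extreme_point_of S \<Longrightarrow> u \<noteq> v \<Longrightarrow> c < g \<bullet> u"
    and x: "x \<in> S" "x \<noteq> v" "a \<bullet> x \<le> a \<bullet> v"
  obtains y where "y \<in> S" "g \<bullet> y = c" "a \<bullet> y \<le> a \<bullet> v" "a \<bullet> x < a \<bullet> v \<Longrightarrow> a \<bullet> y < a \<bullet> v"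
proof -
  define V where "V = {u. u extreme_point_of S} - {v}"
  have hullV: "convex hull V \<subseteq> S"
    using S polytope_imp_convex
    by (intro hull_minimal) (auto simp: V_def extreme_point_of_def)
  have "S = convex hull {u. u extreme_point_of S}"
    by (rule polytope_eq_hull_extreme_points[OF S(1)])
  also have "\<dots> \<subseteq> convex hull (insert v V)"
    by (intro hull_mono) (auto simp: V_def)
  finally have x_hull: "x \<in> convex hull (insert v V)"
    using x by auto
  then have "V \<noteq> {}"
    using x by auto
  then obtain s z where sz: "0 \<le> s" "s \<le> 1" "z \<in> convex hull V" "x = (1 - s) *\<^sub>R v + s *\<^sub>R z"
    using x_hull by (auto simp: convex_hull_insert_alt)
  have "s \<noteq> 0"
    using x sz by auto
  then have s: "s > 0"
    using sz by simp
  have "convex hull V \<subseteq> {y. c < g \<bullet> y}"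
    using others by (intro hull_minimal convex_halfspace_gt) (auto simp: V_def)
  then have gz: "c < g \<bullet> z"
    using sz by auto
  have ax: "a \<bullet> x - a \<bullet> v = s * (a \<bullet> z - a \<bullet> v)"
    by (simp add: sz inner_simps algebra_simps)
  \<comment> \<open>The solution of g(y) = c on the segment from v to z.\<close>
  define t where "t = (c - g \<bullet> v) / (g \<bullet> z - g \<bullet> v)"
  have t: "0 < t" "t < 1"
    using v gz by (auto simp: t_def field_simps)
  define y where "y = (1 - t) *\<^sub>R v + t *\<^sub>R z"
  have ay: "a \<bullet> y - a \<bullet> v = t * (a \<bullet> z - a \<bullet> v)"
    by (simp add: y_def inner_simps algebra_simps)
  show ?thesis
  proof
    show "y \<in> S"
      unfolding y_def using t S sz hullV polytope_imp_convex[OF S(1)]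
      by (auto simp: convex_alt)
    have "g \<bullet> y = g \<bullet> v + t * (g \<bullet> z - g \<bullet> v)"
      by (simp add: y_def inner_simps algebra_simps)
    then show "g \<bullet> y = c"
      using v gz by (simp add: t_def)
    have "a \<bullet> z - a \<bullet> v \<le> 0"
      using ax x s by (metis diff_le_0_iff_le mult_pos_pos not_le)
    then show "a \<bullet> y \<le> a \<bullet> v"
      using ay t by (smt (verit) mult_nonneg_nonpos)
    show "a \<bullet> y < a \<bullet> v" if "a \<bullet> x < a \<bullet> v"
    proof -
      have "a \<bullet> z - a \<bullet> v < 0"
        using ax that s by (metis diff_less_0_iff_less mult_nonneg_nonneg not_le less_imp_le)
      then show ?thesis
        using ay t by (smt (verit) mult_pos_neg)
    qed
  qed
qed

text \<open>Take the smallest face containing u. If u were on its relative frontier, a proper face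
  of it would contain u as well.\<close>

lemma ex_face_rel_interior:
  fixes Q :: "'a::euclidean_space set"
  assumes "polytope Q" "u \<in> Q"
  obtains G where "G face_of Q" "u \<in> rel_interior G"
proof -
  define G where "G = \<Inter> {F. F face_of Q \<and> u \<in> F}"
  have QQ: "Q face_of Q"
    using assms face_of_refl polytope_imp_convex by blast
  then have G: "G face_of Q"
    unfolding G_def using assms by (intro face_of_Inter) auto
  have "u \<in> G"
    by (auto simp: G_def)
  have poly: "polyhedron G"
    using G assms face_of_polytope_polytope polytope_imp_polyhedron by blast
  have "u \<in> rel_interior G"
  proof (rule ccontr)
    assume "u \<notin> rel_interior G"
    then have "u \<in> rel_frontier G"
      using \<open>u \<in> G\<close> poly by (simp add: rel_frontier_def polyhedron_imp_closed)
    then obtain F where F: "F face_of G" "F \<noteq> G" "u \<in> F"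
      using rel_frontier_of_polyhedron_alt[OF poly] by auto
    then have "F face_of Q"
      using G face_of_trans by blast
    then have "G \<subseteq> F"
      using F by (auto simp: G_def)
    then show False
      using F face_of_imp_subset by blast
  qed
  then show ?thesis
    using that G by blast
qed

text \<open>
  A point \<open>u\<close> in the relative interior of a face \<open>G\<close> can be moved in all directions of \<open>G\<close>.
  If it cannot be moved inside a hyperplane, then \<open>G\<close> has dimension at most one.
\<close>

lemma aff_dim_face_le_1:
  fixes Q :: "'a::euclidean_space set"
  assumes u: "u extreme_point_of (Q \<inter> {x. g \<bullet> x = c})"
    and G: "G face_of Q" "u \<in> rel_interior G"
  shows "aff_dim G \<le> 1"
proof (cases "G = {u}")
  case False
  have "u \<in> G" and gu: "g \<bullet> u = c"
    using G(2) u rel_interior_subset by (auto simp: extreme_point_of_def)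
  obtain e where e: "e > 0" "cball u e \<inter> affine hull G \<subseteq> G"
    using G(2) mem_rel_interior_cball by blast
  have zero: "d = 0" if d: "u + d \<in> affine hull G" "g \<bullet> d = 0" for d
  proof (rule ccontr)
    assume "d \<noteq> 0"
    define t where "t = e / norm d"
    have t: "t > 0" "norm (t *\<^sub>R d) = e"
      using \<open>d \<noteq> 0\<close> e by (auto simp: t_def)
    have aff: "u + s *\<^sub>R d \<in> affine hull G" for s
      using mem_affine_3_minus[of "affine hull G" u "u + d" u s] d \<open>u \<in> G\<close> by (simp add: hull_inc)
    have "u + t *\<^sub>R d \<in> G" "u + (- t) *\<^sub>R d \<in> G"
      using e t aff[of t] aff[of "- t"] by (auto simp: dist_norm)
    then have "u + t *\<^sub>R d \<in> Q \<inter> {x. g \<bullet> x = c}" "u + (- t) *\<^sub>R d \<in> Q \<inter> {x. g \<bullet> x = c}"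
      using G(1) face_of_imp_subset d gu by (auto simp: inner_simps)
    moreover have "u \<in> open_segment (u + t *\<^sub>R d) (u + (- t) *\<^sub>R d)"
    proof -
      have "u + t *\<^sub>R d \<noteq> u + (- t) *\<^sub>R d"
      proof
        assume "u + t *\<^sub>R d = u + (- t) *\<^sub>R d"
        then have "t = - t"
          using \<open>d \<noteq> 0\<close> by (simp only: add_left_cancel scaleR_cancel_right) simp
        then show False
          using t by simp
      qed
      moreover have "u = (1 - 1/2) *\<^sub>R (u + t *\<^sub>R d) + (1/2) *\<^sub>R (u + (- t) *\<^sub>R d)"
        by (simp add: algebra_simps flip: scaleR_left_distrib)
      ultimately show ?thesis
        unfolding in_segment by (intro conjI exI[of _ "1/2"]) auto
    qed
    ultimately show False
      using u by (auto simp: extreme_point_of_def)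
  qed
  obtain p where p: "p \<in> G" "p \<noteq> u"
    using False \<open>u \<in> G\<close> by blast
  have gp: "g \<bullet> (p - u) \<noteq> 0"
  proof
    assume "g \<bullet> (p - u) = 0"
    moreover have "u + (p - u) \<in> affine hull G"
      using p by (simp add: hull_inc)
    ultimately have "p - u = 0"
      by (intro zero)
    then show False
      using p by simp
  qed
  have "G \<subseteq> affine hull {u, p}"
  proof
    fix x assume x: "x \<in> G"
    \<comment> \<open>With this factor, x - u - k (p - u) is a direction of G inside the hyperplane,
      hence 0 by \<open>zero\<close>.\<close>
    define k where "k = (g \<bullet> (x - u)) / (g \<bullet> (p - u))"
    have "u + 1 *\<^sub>R (x - u) \<in> affine hull G"
      using x by (simp add: hull_inc)
    then have "(u + 1 *\<^sub>R (x - u)) + (- k) *\<^sub>R (p - u) \<in> affine hull G"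
      using p \<open>u \<in> G\<close> by (intro mem_affine_3_minus) (auto simp: hull_inc)
    then have "u + ((x - u) - k *\<^sub>R (p - u)) \<in> affine hull G"
      by (simp add: algebra_simps)
    moreover have "g \<bullet> ((x - u) - k *\<^sub>R (p - u)) = 0"
      using gp by (simp add: k_def inner_diff_right[of g "x - u"])
    ultimately have "(x - u) - k *\<^sub>R (p - u) = 0"
      by (intro zero)
    then have "x = (1 - k) *\<^sub>R u + k *\<^sub>R p"
      by (simp add: algebra_simps)
    then show "x \<in> affine hull {u, p}"
      unfolding affine_hull_2 by (intro CollectI exI[of _ "1 - k"] exI[of _ k]) simp
  qed
  then have "aff_dim G \<le> aff_dim {u, p}"
    by (metis aff_dim_affine_hull aff_dim_subset)
  also have "\<dots> \<le> 1"
    using aff_dim_2[of u p] by (auto split: if_splits)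
  finally show ?thesis .
qed simp

text \<open>
  The slice of \<open>Q\<close> by a hyperplane cutting off \<open>v\<close> is the vertex figure, whose vertices lie on
  the edges through \<open>v\<close>. Minimize the functional over it.
\<close>

lemma ex_improving_edge:
  fixes Q :: "'a::euclidean_space set"
  assumes Q: "polytope Q" "v extreme_point_of Q"
    and w: "w \<in> Q" "w \<noteq> v" "a \<bullet> w \<le> a \<bullet> v"
  obtains b where "b \<noteq> v" "closed_segment v b edge_of Q" "a \<bullet> b \<le> a \<bullet> v"
    "a \<bullet> w < a \<bullet> v \<Longrightarrow> a \<bullet> b < a \<bullet> v"
proof -
  obtain g c where gc: "g \<bullet> v < c" "\<And>u. u extreme_point_of Q \<Longrightarrow> u \<noteq> v \<Longrightarrow> c < g \<bullet> u"
    using ex_hyperplane_cutting_vertex[OF Q] by blast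
  have "v \<in> Q"
    using Q by (simp add: extreme_point_of_def)
  obtain y where y: "y \<in> Q" "g \<bullet> y = c" "a \<bullet> y \<le> a \<bullet> v" "a \<bullet> w < a \<bullet> v \<Longrightarrow> a \<bullet> y < a \<bullet> v"
    using ex_point_on_cutting_hyperplane[OF Q(1) \<open>v \<in> Q\<close> gc w] by blast
  define H where "H = {x. g \<bullet> x = c}"
  have "polytope (Q \<inter> H)"
    unfolding H_def by (intro polytope_Int_polyhedron Q polyhedron_hyperplane)
  then obtain u where u: "u extreme_point_of (Q \<inter> H)" "\<And>x. x \<in> Q \<inter> H \<Longrightarrow> a \<bullet> u \<le> a \<bullet> x"
    using ex_extreme_minimizer[of "Q \<inter> H" a] y polytope_imp_compact polytope_imp_convex
    by (auto simp: H_def)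
  then have "u \<in> Q" "g \<bullet> u = c"
    by (auto simp: extreme_point_of_def H_def)
  then obtain G where G: "G face_of Q" "u \<in> rel_interior G"
    using ex_face_rel_interior[OF Q(1)] by blast
  then have "u \<in> G"
    using rel_interior_subset by blast
  have dim: "aff_dim G \<le> 1"
    using aff_dim_face_le_1 G u(1) unfolding H_def by blast
  moreover have "polytope G"
    using G Q face_of_polytope_polytope by blast
  ultimately have "compact G" "convex G" "collinear G"
    by (simp_all add: polytope_imp_compact polytope_imp_convex collinear_aff_dim)
  then obtain p q where pq: "G = closed_segment p q"
    using compact_convex_collinear_segment \<open>u \<in> G\<close> by blast
  have ext: "p extreme_point_of Q" "q extreme_point_of Q"
    using extreme_point_of_face[OF G(1)] pq extreme_point_of_segment by blast+
  \<comment> \<open>The segment G meets the hyperplane in u, so its end points cannot both lie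
    strictly beyond it. All vertices except v do, so v is one of the end points.\<close>
  have "\<not> (c < g \<bullet> p \<and> c < g \<bullet> q)"
  proof
    assume "c < g \<bullet> p \<and> c < g \<bullet> q"
    then have "closed_segment p q \<subseteq> {x. c < g \<bullet> x}"
      by (intro closed_segment_subset convex_halfspace_gt) auto
    then show False
      using \<open>u \<in> G\<close> \<open>g \<bullet> u = c\<close> pq by auto
  qed
  then have "p = v \<or> q = v"
    using gc(2) ext by blast
  then obtain b where b: "G = closed_segment v b"
    using pq closed_segment_commute by metis
  have "u \<noteq> v"
    using gc \<open>g \<bullet> u = c\<close> by auto
  then have "b \<noteq> v"
    using b \<open>u \<in> G\<close> by auto
  obtain s where s: "0 \<le> s" "s \<le> 1" "u = (1 - s) *\<^sub>R v + s *\<^sub>R b"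
    using \<open>u \<in> G\<close> b by (auto simp: in_segment)
  have "s \<noteq> 0"
    using s \<open>u \<noteq> v\<close> by auto
  then have "s > 0"
    using s by simp
  have au: "a \<bullet> u - a \<bullet> v = s * (a \<bullet> b - a \<bullet> v)"
    by (simp add: s inner_simps algebra_simps)
  have auy: "a \<bullet> u \<le> a \<bullet> y"
    using u(2) y by (auto simp: H_def)
  show ?thesis
  proof
    show "b \<noteq> v" by fact
    have "aff_dim G = 1"
    proof -
      have "aff_dim {v, b} \<le> aff_dim G"
        using b by (intro aff_dim_subset) auto
      then show ?thesis
        using dim \<open>b \<noteq> v\<close> by (simp add: aff_dim_2)
    qed
    then show "closed_segment v b edge_of Q"
      using G b by (simp add: edge_of_def)
    show "a \<bullet> b \<le> a \<bullet> v"
      using au auy y \<open>s > 0\<close> by (smt (verit) mult_pos_pos)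
    show "a \<bullet> b < a \<bullet> v" if "a \<bullet> w < a \<bullet> v"
      using au auy y(4)[OF that] \<open>s > 0\<close> by (smt (verit) mult_nonneg_nonneg)
  qed
qed

section \<open>Vertex orders and the functionals minimized at a vertex\<close>

text \<open>These are the directions $e_j - e_i$ in the tangent cone at v. For i = j the direction
  is 0, which makes the relation reflexive.\<close>

definition vertex_order :: "(real ^ 'n) set \<Rightarrow> real ^ 'n \<Rightarrow> 'n::finite rel" where
  "vertex_order Q v = {(i, j). \<exists>t>0. v + t *\<^sub>R (axis j 1 - axis i 1) \<in> Q}"

lemma functional_eq_inner: "functional f x = (\<chi> i. real (f i)) \<bullet> x"
  by (simp add: functional_def inner_vec_def)

lemma functional_shift:
  "functional f (v + t *\<^sub>R (axis j 1 - axis i 1)) = functional f v + t * (real (f j) - real (f i))"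
  by (simp add: functional_eq_inner inner_simps inner_axis)

lemma vertex_order_shrink:
  assumes "convex Q" "v \<in> Q" "v + t *\<^sub>R d \<in> Q" "0 \<le> r" "r \<le> t"
  shows "v + r *\<^sub>R d \<in> Q"
proof (cases "t = 0")
  case False
  then have "v + r *\<^sub>R d = (1 - r / t) *\<^sub>R v + (r / t) *\<^sub>R (v + t *\<^sub>R d)"
    by (simp add: algebra_simps)
  also have "\<dots> \<in> Q"
    using assms False by (intro convexD_alt) auto
  finally show ?thesis .
qed (use assms in auto)

text \<open>Two feasible steps can be shortened to a common length r (\<open>common\<close>). For
  transitivity, the midpoint of the two shifted points is v moved by r/2 along the sum of both
  directions. For antisymmetry, opposite steps would make v the midpoint of a segment in Q, although
  it is extreme.\<close>

lemma partial_order_on_vertex_order: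
  assumes "convex Q" "v extreme_point_of Q"
  shows "partial_order_on UNIV (vertex_order Q v)"
proof -
  have v: "v \<in> Q"
    using assms by (simp add: extreme_point_of_def)
  have common: "\<exists>r>0. v + r *\<^sub>R (axis j 1 - axis i 1) \<in> Q \<and> v + r *\<^sub>R (axis l 1 - axis k 1) \<in> Q"
    if le: "(i, j) \<in> vertex_order Q v" "(k, l) \<in> vertex_order Q v" for i j k l
  proof -
    obtain t s where "0 < t" "v + t *\<^sub>R (axis j 1 - axis i 1) \<in> Q" "0 < s" "v + s *\<^sub>R (axis l 1 - axis k 1) \<in> Q"
      using le by (auto simp: vertex_order_def)
    then show ?thesis
      using assms(1) v by (intro exI[of _ "min t s"]) (auto intro: vertex_order_shrink)
  qed
  have "refl (vertex_order Q v)"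
    using v by (auto simp: refl_on_def vertex_order_def intro!: exI[of _ 1])
  moreover have "trans (vertex_order Q v)"
  proof (rule transI)
    fix i j k assume "(i, j) \<in> vertex_order Q v" "(j, k) \<in> vertex_order Q v"
    from common[OF this] obtain r where r: "r > 0"
      "v + r *\<^sub>R (axis j 1 - axis i 1) \<in> Q" "v + r *\<^sub>R (axis k 1 - axis j 1) \<in> Q"
      by blast
    have "(1 - 1/2) *\<^sub>R (v + r *\<^sub>R (axis j 1 - axis i 1)) + (1/2) *\<^sub>R (v + r *\<^sub>R (axis k 1 - axis j 1)) \<in> Q"
      using r assms(1) by (intro convexD_alt) auto
    also have "(1 - 1/2) *\<^sub>R (v + r *\<^sub>R (axis j 1 - axis i 1)) + (1/2) *\<^sub>R (v + r *\<^sub>R (axis k 1 - axis j 1))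
        = v + (r/2) *\<^sub>R (axis k 1 - axis i 1)"
      by (simp add: vec_eq_iff field_simps)
    finally show "(i, k) \<in> vertex_order Q v"
      using r by (auto simp: vertex_order_def intro!: exI[of _ "r/2"])
  qed
  moreover have "antisym (vertex_order Q v)"
  proof (rule antisymI, rule ccontr)
    fix i j assume ij: "(i, j) \<in> vertex_order Q v" "(j, i) \<in> vertex_order Q v" "i \<noteq> j"
    let ?d = "axis j 1 - axis i (1::real)"
    from common[OF ij(1,2)] obtain r where r: "r > 0" "v + r *\<^sub>R ?d \<in> Q" "v + r *\<^sub>R (axis i 1 - axis j 1) \<in> Q"
      by blast
    have "?d \<noteq> 0"
      using ij(3) by (simp add: axis_eq_axis)
    then have ne: "v + r *\<^sub>R ?d \<noteq> v + r *\<^sub>R (axis i 1 - axis j 1)"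
      using r by (auto simp: vec_eq_iff axis_def)
    have "v = (1 - 1/2) *\<^sub>R (v + r *\<^sub>R ?d) + (1/2) *\<^sub>R (v + r *\<^sub>R (axis i 1 - axis j 1))"
      by (simp add: vec_eq_iff field_simps)
    then have "v \<in> open_segment (v + r *\<^sub>R ?d) (v + r *\<^sub>R (axis i 1 - axis j 1))"
      unfolding in_segment using ne by (intro conjI exI[of _ "1/2"]) auto
    then show False
      using assms(2) r by (auto simp: extreme_point_of_def)
  qed
  ultimately show ?thesis
    by (simp add: partial_order_on_def preorder_on_def)
qed

text \<open>Here the edge condition of a generalized permutohedron enters: the improving edge at v
  is parallel to some $e_j - e_i$, so its direction is a pair in the vertex order.\<close>

lemma ex_improving_root:
  assumes Q: "generalized_permutohedron Q" "v \<in> vertices Q"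
    and w: "w \<in> Q" "w \<noteq> v" "functional f w \<le> functional f v"
  obtains i j where "i \<noteq> j" "(i, j) \<in> vertex_order Q v" "f j \<le> f i"
    "functional f w < functional f v \<Longrightarrow> f j < f i"
proof -
  obtain b where b: "b \<noteq> v" "closed_segment v b edge_of Q" "functional f b \<le> functional f v"
    "functional f w < functional f v \<Longrightarrow> functional f b < functional f v"
    using ex_improving_edge[of Q v w "\<chi> i. real (f i)"] Q w
    by (auto simp: generalized_permutohedron_def vertices_def functional_eq_inner)
  obtain i j c where ij: "i \<noteq> j" "b - v = c *\<^sub>R (axis i 1 - axis j 1)"
    using Q(1) b(2) unfolding generalized_permutohedron_def by (metis ends_in_segment)
  have "b \<in> Q"
    using b(2) edge_of_imp_subset by blast
  \<comment> \<open>The sign of the factor decides in which order the two indices are taken.\<close>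
  have "\<exists>i j c. i \<noteq> j \<and> c > 0 \<and> b = v + c *\<^sub>R (axis j 1 - axis i 1)"
  proof (cases "c > 0")
    case True
    then show ?thesis
      using ij by (intro exI[of _ j] exI[of _ i] exI[of _ c]) (auto simp: algebra_simps)
  next
    case False
    moreover have "c \<noteq> 0"
      using ij b by auto
    ultimately show ?thesis
      using ij by (intro exI[of _ i] exI[of _ j] exI[of _ "- c"]) (auto simp: algebra_simps)
  qed
  then obtain i j c where ij: "i \<noteq> j" "c > 0" "b = v + c *\<^sub>R (axis j 1 - axis i 1)"
    by blast
  show ?thesis
  proof
    show "i \<noteq> j" by fact
    show "(i, j) \<in> vertex_order Q v"
      using ij \<open>b \<in> Q\<close> by (auto simp: vertex_order_def)
    have fb: "functional f b - functional f v = c * (real (f j) - real (f i))"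
      by (simp add: ij functional_shift)
    show "f j \<le> f i"
      using fb b(3) ij(2) by (smt (verit) mult_pos_pos of_nat_le_iff)
    show "f j < f i" if "functional f w < functional f v"
      using fb b(4)[OF that] ij(2) by (smt (verit) mult_nonneg_nonneg of_nat_less_iff)
  qed
qed

lemma vertex_mem: "v \<in> vertices Q \<Longrightarrow> v \<in> Q"
  by (simp add: vertices_def extreme_point_of_def)

lemma vertex_minimizes_iff:
  assumes Q: "generalized_permutohedron Q" "v \<in> vertices Q"
  shows "v \<in> minimizers Q f \<longleftrightarrow> (\<forall>i j. (i, j) \<in> vertex_order Q v \<longrightarrow> f i \<le> f j)"
proof (intro iffI allI impI)
  fix i j assume v: "v \<in> minimizers Q f" and "(i, j) \<in> vertex_order Q v"
  then obtain t where t: "t > 0" "v + t *\<^sub>R (axis j 1 - axis i 1) \<in> Q"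
    by (auto simp: vertex_order_def)
  then have "functional f v \<le> functional f (v + t *\<^sub>R (axis j 1 - axis i 1))"
    using v unfolding minimizers_def by blast
  then have "0 \<le> t * (real (f j) - real (f i))"
    by (simp add: functional_shift)
  then show "f i \<le> f j"
    using t by (simp add: zero_le_mult_iff)
next
  assume *: "\<forall>i j. (i, j) \<in> vertex_order Q v \<longrightarrow> f i \<le> f j"
  have "functional f v \<le> functional f w" if "w \<in> Q" for w
  proof (rule ccontr)
    assume "\<not> functional f v \<le> functional f w"
    then show False
      using ex_improving_root[OF Q that, of f] * by (metis linorder_not_less nle_le)
  qed
  then show "v \<in> minimizers Q f"
    using Q vertex_mem by (auto simp: minimizers_def)
qed

lemma vertex_unique_minimizer_iff:
  assumes Q: "generalized_permutohedron Q" "v \<in> vertices Q"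
  shows "minimizers Q f = {v} \<longleftrightarrow> (\<forall>i j. (i, j) \<in> vertex_order Q v \<and> i \<noteq> j \<longrightarrow> f i < f j)"
proof (intro iffI allI impI)
  fix i j assume min: "minimizers Q f = {v}" and ij: "(i, j) \<in> vertex_order Q v \<and> i \<noteq> j"
  then obtain t where t: "t > 0" "v + t *\<^sub>R (axis j 1 - axis i 1) \<in> Q"
    by (auto simp: vertex_order_def)
  let ?w = "v + t *\<^sub>R (axis j 1 - axis i 1)"
  have "f i \<le> f j"
    using vertex_minimizes_iff[OF Q, of f] min ij by auto
  moreover have "f i \<noteq> f j"
  proof
    assume "f i = f j"
    then have "functional f ?w = functional f v"
      by (simp add: functional_shift)
    moreover have "v \<in> minimizers Q f"
      using min by simp
    ultimately have "?w \<in> minimizers Q f"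
      using t unfolding minimizers_def by simp
    then have "?w = v"
      using min by blast
    then show False
      using t ij by (simp add: axis_eq_axis)
  qed
  ultimately show "f i < f j"
    by simp
next
  assume *: "\<forall>i j. (i, j) \<in> vertex_order Q v \<and> i \<noteq> j \<longrightarrow> f i < f j"
  then have v: "v \<in> minimizers Q f"
    unfolding vertex_minimizes_iff[OF Q] by (metis le_refl less_imp_le)
  have "w = v" if w: "w \<in> minimizers Q f" for w
  proof (rule ccontr)
    assume "w \<noteq> v"
    moreover have "w \<in> Q" "functional f w \<le> functional f v"
      using w v by (auto simp: minimizers_def)
    ultimately show False
      using ex_improving_root[OF Q, of w f] * by (metis linorder_not_less)
  qed
  then show "minimizers Q f = {v}"
    using v by blast
qed

lemma ex_minimizing_vertex:
  assumes "polytope Q" "Q \<noteq> {}"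
  obtains v where "v \<in> vertices Q" "v \<in> minimizers Q f"
proof -
  obtain u where "u extreme_point_of Q" "\<And>x. x \<in> Q \<Longrightarrow> (\<chi> i. real (f i)) \<bullet> u \<le> (\<chi> i. real (f i)) \<bullet> x"
    using ex_extreme_minimizer[of Q] assms polytope_imp_compact polytope_imp_convex by metis
  then show ?thesis
    using that[of u] by (auto simp: vertices_def minimizers_def functional_eq_inner extreme_point_of_def)
qed

text \<open>For injective f, being weakly and being strictly increasing along a vertex order
  coincide, so a vertex that minimizes f is the only minimizer.\<close>

lemma injective_unique_minimizing_vertex:
  assumes Q: "generalized_permutohedron Q" and "inj f"
  shows "\<exists>!v. v \<in> vertices Q \<and> minimizers Q f = {v}"
proof -
  obtain v where v: "v \<in> vertices Q" "v \<in> minimizers Q f"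
    using ex_minimizing_vertex Q unfolding generalized_permutohedron_def by metis
  have "\<forall>i j. (i, j) \<in> vertex_order Q v \<and> i \<noteq> j \<longrightarrow> f i < f j"
    using v(2) assms(2) unfolding vertex_minimizes_iff[OF Q v(1)] by (metis inj_eq le_neq_implies_less)
  then have "minimizers Q f = {v}"
    unfolding vertex_unique_minimizer_iff[OF Q v(1)] .
  then show ?thesis
    using v(1) by auto
qed

lemma finite_vertices: "polytope Q \<Longrightarrow> finite (vertices Q)"
  by (simp add: vertices_def finite_extreme_points)

subsection \<open>Inclusion-exclusion for decompositions\<close>

text \<open>Between a point s slightly to the left of t and t itself, the indicator of an interval
  rises exactly if the interval starts at t. Hence for each t the coefficients of the intervals
  starting there sum to 0.\<close>

lemma sum_intervals_eq_0:
  fixes \<alpha> :: "'i \<Rightarrow> int" and lo hi :: "'i \<Rightarrow> real"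
  assumes fin: "finite I" and le: "\<And>i. i \<in> I \<Longrightarrow> lo i \<le> hi i"
    and zero: "\<And>t. (\<Sum>i\<in>I. \<alpha> i * of_bool (lo i \<le> t \<and> t \<le> hi i)) = 0"
  shows "(\<Sum>i\<in>I. \<alpha> i) = 0"
proof -
  have jump: "(\<Sum>i\<in>I. \<alpha> i * of_bool (lo i = t)) = 0" for t
  proof -
    \<comment> \<open>The point \<open>s\<close> lies strictly between t and all end points below t;
      the element \<open>t - 1\<close> makes the maximum exist in any case.\<close>
    define X where "X = insert (t - 1) {x \<in> lo ` I \<union> hi ` I. x < t}"
    define s where "s = (Max X + t) / 2"
    have X: "finite X" "X \<noteq> {}"
      using fin by (auto simp: X_def)
    have "Max X \<in> X"
      using X by (rule Max_in)
    then have "Max X < t"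
      by (auto simp: X_def)
    then have s: "s < t" "\<And>x. x \<in> X \<Longrightarrow> x < s"
      using Max_ge[OF X(1)] by (fastforce simp: s_def)+
    have iff: "lo i \<le> s \<and> s \<le> hi i \<longleftrightarrow> lo i < t \<and> t \<le> hi i" if "i \<in> I" for i
    proof -
      have "lo i < t \<Longrightarrow> lo i < s" "hi i < t \<Longrightarrow> hi i < s"
        using s(2) that by (auto simp: X_def)
      then show ?thesis
        using s(1) by linarith
    qed
    have "(\<Sum>i\<in>I. \<alpha> i * of_bool (lo i = t))
        = (\<Sum>i\<in>I. \<alpha> i * of_bool (lo i \<le> t \<and> t \<le> hi i) - \<alpha> i * of_bool (lo i \<le> s \<and> s \<le> hi i))"
      using le iff by (intro sum.cong) auto
    also have "\<dots> = 0"
      using zero by (simp add: sum_subtractf)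
    finally show ?thesis .
  qed
  have "(\<Sum>i\<in>I. \<alpha> i) = (\<Sum>t\<in>lo ` I. \<Sum>i\<in>{i \<in> I. lo i = t}. \<alpha> i)"
    by (rule sum.image_gen[OF fin])
  also have "\<dots> = (\<Sum>t\<in>lo ` I. \<Sum>i\<in>I. \<alpha> i * of_bool (lo i = t))"
    using fin by (intro sum.cong refl sum.mono_neutral_cong_left) auto
  finally show ?thesis
    by (simp add: jump)
qed

text \<open>
  The Euler characteristic is additive: it is computed by projecting away one coordinate at a
  time, and for intervals it counts the left end points.
\<close>

lemma sum_compact_convex_eq_0:
  fixes C :: "'i \<Rightarrow> 'a::euclidean_space set" and \<alpha> :: "'i \<Rightarrow> int"
  assumes fin: "finite I"
    and C: "\<And>i. i \<in> I \<Longrightarrow> compact (C i)" "\<And>i. i \<in> I \<Longrightarrow> convex (C i)"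
    and zero: "\<And>x. (\<Sum>i\<in>I. \<alpha> i * of_bool (x \<in> C i)) = 0"
  shows "(\<Sum>i\<in>I. \<alpha> i * of_bool (C i \<noteq> {})) = 0"
proof -
  \<comment> \<open>The induction runs over the set \<open>B\<close> of coordinates that are still
    free; in the others all points of the sets agree with \<open>q\<close>. Once \<open>B\<close> is
    empty, each set is empty or the same single point, and nonemptiness is membership of that
    point.\<close>
  have main: "(\<Sum>i\<in>I. \<alpha> i * of_bool (C i \<noteq> {})) = 0"
    if "finite B" "B \<subseteq> Basis"
      "\<And>i. i \<in> I \<Longrightarrow> compact (C i)" "\<And>i. i \<in> I \<Longrightarrow> convex (C i)"
      "\<And>i x b. i \<in> I \<Longrightarrow> x \<in> C i \<Longrightarrow> b \<in> Basis - B \<Longrightarrow> x \<bullet> b = q b"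
      "\<And>x. (\<Sum>i\<in>I. \<alpha> i * of_bool (x \<in> C i)) = 0"
    for B and C :: "'i \<Rightarrow> 'a set" and q
    using that
  proof (induction B arbitrary: C q rule: finite_induct)
    case empty
    define p where "p = (\<Sum>b\<in>Basis. q b *\<^sub>R b)"
    have "x = p" if "i \<in> I" "x \<in> C i" for i x
    proof (rule euclidean_eqI)
      fix b :: 'a assume "b \<in> Basis"
      then show "x \<bullet> b = p \<bullet> b"
        using empty.prems(4)[OF that, of b] by (simp add: p_def)
    qed
    then have "C i \<noteq> {} \<longleftrightarrow> p \<in> C i" if "i \<in> I" for i
      using that by blast
    then have "(\<Sum>i\<in>I. \<alpha> i * of_bool (C i \<noteq> {})) = (\<Sum>i\<in>I. \<alpha> i * of_bool (p \<in> C i))"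
      by (intro sum.cong) auto
    then show ?case
      using empty.prems(5) by simp
  next
    case (insert b B)
    define I' where "I' = {i \<in> I. C i \<noteq> {}}"
    have I': "finite I'" "I' \<subseteq> I"
      using fin by (auto simp: I'_def)
    have "\<exists>l h. l \<le> h \<and> (\<lambda>x. x \<bullet> b) ` C i = {l..h}" if i: "i \<in> I'" for i
    proof -
      have "compact (C i)" "convex (C i)"
        using insert.prems(2,3) i I'(2) by blast+
      then have "compact (C i)" "connected (C i)"
        by (auto intro: convex_connected)
      then have "compact ((\<lambda>x. x \<bullet> b) ` C i)" "connected ((\<lambda>x. x \<bullet> b) ` C i)"
        by (auto intro!: compact_continuous_image connected_continuous_image continuous_intros)
      then obtain l h where "(\<lambda>x. x \<bullet> b) ` C i = {l..h}"
        using connected_compact_interval_1[of "(\<lambda>x. x \<bullet> b) ` C i"] by auto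
      moreover have "(\<lambda>x. x \<bullet> b) ` C i \<noteq> {}"
        using i by (simp add: I'_def)
      ultimately show ?thesis
        by (metis atLeastatMost_empty_iff)
    qed
    then obtain lo hi where lohi: "\<And>i. i \<in> I' \<Longrightarrow> lo i \<le> hi i"
      "\<And>i. i \<in> I' \<Longrightarrow> (\<lambda>x. x \<bullet> b) ` C i = {lo i..hi i}"
      by metis
    have hyper: "closed {x. x \<bullet> b = t}" "convex {x. x \<bullet> b = t}" for t
      using closed_hyperplane[of b t] convex_hyperplane[of b t] by (simp_all add: inner_commute)
    \<comment> \<open>Fixing coordinate \<open>b\<close> at \<open>t\<close> leaves one free
      coordinate fewer. As a slice is nonempty iff \<open>t\<close> lies in the projection of the
      set to that coordinate, the result is a statement about intervals.\<close>
    have slice: "(\<Sum>i\<in>I. \<alpha> i * of_bool (C i \<inter> {x. x \<bullet> b = t} \<noteq> {})) = 0" for t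
    proof (rule insert.IH[where q = "q(b := t)"])
      show "B \<subseteq> Basis"
        using insert.prems by simp
      show "compact (C i \<inter> {x. x \<bullet> b = t})" if "i \<in> I" for i
        using insert.prems(2)[OF that] hyper(1) by (rule compact_Int_closed)
      show "convex (C i \<inter> {x. x \<bullet> b = t})" if "i \<in> I" for i
        using insert.prems(3)[OF that] hyper(2) by (rule convex_Int)
      show "x \<bullet> b' = (q(b := t)) b'"
        if "i \<in> I" "x \<in> C i \<inter> {x. x \<bullet> b = t}" "b' \<in> Basis - B" for i x b'
        using that insert.prems(4)[of i x b'] by auto
      show "(\<Sum>i\<in>I. \<alpha> i * of_bool (x \<in> C i \<inter> {x. x \<bullet> b = t})) = 0" for x
        using insert.prems(5)[of x] by (cases "x \<bullet> b = t") auto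
    qed
    have "(\<Sum>i\<in>I'. \<alpha> i * of_bool (lo i \<le> t \<and> t \<le> hi i)) = 0" for t
    proof -
      have "(\<Sum>i\<in>I'. \<alpha> i * of_bool (lo i \<le> t \<and> t \<le> hi i))
          = (\<Sum>i\<in>I'. \<alpha> i * of_bool (C i \<inter> {x. x \<bullet> b = t} \<noteq> {}))"
      proof (intro sum.cong refl)
        fix i assume "i \<in> I'"
        then have "t \<in> {lo i..hi i} \<longleftrightarrow> C i \<inter> {x. x \<bullet> b = t} \<noteq> {}"
          unfolding lohi(2)[OF \<open>i \<in> I'\<close>, symmetric] by auto
        then show "\<alpha> i * of_bool (lo i \<le> t \<and> t \<le> hi i)
            = \<alpha> i * of_bool (C i \<inter> {x. x \<bullet> b = t} \<noteq> {})"
          by simp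
      qed
      also have "\<dots> = (\<Sum>i\<in>I. \<alpha> i * of_bool (C i \<inter> {x. x \<bullet> b = t} \<noteq> {}))"
        using fin by (intro sum.mono_neutral_left) (auto simp: I'_def)
      finally show ?thesis
        using slice by simp
    qed
    with I'(1) lohi(1) have "(\<Sum>i\<in>I'. \<alpha> i) = 0"
      by (rule sum_intervals_eq_0)
    moreover have "(\<Sum>i\<in>I. \<alpha> i * of_bool (C i \<noteq> {})) = (\<Sum>i\<in>I'. \<alpha> i * of_bool (C i \<noteq> {}))"
      by (rule sum.mono_neutral_right[OF fin I'(2)]) (simp add: I'_def)
    moreover have "(\<Sum>i\<in>I'. \<alpha> i * of_bool (C i \<noteq> {})) = (\<Sum>i\<in>I'. \<alpha> i)"
      by (rule sum.cong) (simp_all add: I'_def)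
    ultimately show ?case
      by linarith
  qed
  show ?thesis
    by (rule main[of Basis C "\<lambda>_. 0"]) (simp_all add: C zero)
qed

text \<open>The union and all intersections of the family are compact and convex, and ordinary
  inclusion-exclusion at each point x is a vanishing combination of their indicators.\<close>

lemma inclusion_exclusion_nonempty:
  fixes R :: "'i \<Rightarrow> 'a::euclidean_space set"
  assumes fin: "finite I"
    and R: "\<And>i. i \<in> I \<Longrightarrow> compact (R i)" "\<And>i. i \<in> I \<Longrightarrow> convex (R i)"
    and conv: "convex (\<Union>i\<in>I. R i)"
  shows "(of_bool ((\<Union>i\<in>I. R i) \<noteq> {}) :: int)
    = (\<Sum>J | J \<subseteq> I \<and> J \<noteq> {}. (-1) ^ (card J + 1) * of_bool ((\<Inter>i\<in>J. R i) \<noteq> {}))"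
proof -
  let ?P = "{J. J \<subseteq> I \<and> J \<noteq> {}}"
  \<comment> \<open>The empty index set stands for the union, which gets coefficient -1, so that
    both sides of the identity become one sum over \<open>Pow I\<close>.\<close>
  define K where "K J = (if J = {} then \<Union>i\<in>I. R i else \<Inter>i\<in>J. R i)" for J
  define \<alpha> :: "'i set \<Rightarrow> int" where "\<alpha> J = (if J = {} then -1 else (-1) ^ (card J + 1))" for J
  have finP: "finite ?P"
    using fin by (rule rev_finite_subset[OF finite_Pow_iff[THEN iffD2]]) auto
  have Pow: "Pow I = insert {} ?P"
    by auto
  have split: "(\<Sum>J\<in>Pow I. \<alpha> J * of_bool (p (K J)))
      = - of_bool (p (\<Union>i\<in>I. R i)) + (\<Sum>J\<in>?P. (-1) ^ (card J + 1) * of_bool (p (\<Inter>i\<in>J. R i)))"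
    for p :: "'a set \<Rightarrow> bool"
  proof -
    have "(\<Sum>J\<in>Pow I. \<alpha> J * of_bool (p (K J)))
        = \<alpha> {} * of_bool (p (K {})) + (\<Sum>J\<in>?P. \<alpha> J * of_bool (p (K J)))"
      unfolding Pow using finP by (intro sum.insert) auto
    also have "(\<Sum>J\<in>?P. \<alpha> J * of_bool (p (K J)))
        = (\<Sum>J\<in>?P. (-1) ^ (card J + 1) * of_bool (p (\<Inter>i\<in>J. R i)))"
      by (intro sum.cong) (auto simp: \<alpha>_def K_def)
    finally show ?thesis
      by (simp add: \<alpha>_def K_def)
  qed
  have "(\<Sum>J\<in>Pow I. \<alpha> J * of_bool (K J \<noteq> {})) = 0"
  proof (rule sum_compact_convex_eq_0)
    show "finite (Pow I)"
      using fin by simp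
    show "compact (K J)" if "J \<in> Pow I" for J
    proof (cases "J = {}")
      case True
      then show ?thesis
        using fin R by (auto simp: K_def intro: compact_UN)
    next
      case False
      then show ?thesis
        using that R by (auto simp: K_def intro!: compact_Inter)
    qed
    show "convex (K J)" if "J \<in> Pow I" for J
      using that R conv by (auto simp: K_def intro!: convex_INT)
    show "(\<Sum>J\<in>Pow I. \<alpha> J * of_bool (x \<in> K J)) = 0" for x
      unfolding split[of "\<lambda>S. x \<in> S"]
      by (subst Incl_Excl_UN[of "\<lambda>S. of_bool (x \<in> S)" I R]) (auto simp: fin disjnt_iff)
  qed
  then show ?thesis
    using split[of "\<lambda>S. S \<noteq> {}"] by simp
qed

section \<open>Generic functionals on the pieces of a decomposition\<close>

text \<open>If v is in S, a competitor of v can be moved onto the hyperplane by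
  \<open>ex_point_on_cutting_hyperplane\<close>. If not, S lies strictly beyond the hyperplane and
  all three indicators vanish. The right side consists of indicators of nonemptiness, to which
  inclusion-exclusion applies.\<close>

lemma unique_minimizer_indicator:
  fixes S :: "(real ^ 'n::finite) set"
  assumes S: "polytope S" and g: "g \<bullet> v < c"
    and others: "\<And>u. u \<in> vertices S \<Longrightarrow> u \<noteq> v \<Longrightarrow> c < g \<bullet> u"
  shows "(of_bool (minimizers S f = {v}) :: int) = of_bool (S \<inter> {v} \<noteq> {})
    - of_bool (S \<inter> ({x. g \<bullet> x = c} \<inter> {x. functional f x \<le> functional f v}) \<noteq> {})"
proof (cases "v \<in> S")
  case True
  have "minimizers S f = {v} \<longleftrightarrow> (\<forall>x\<in>S. x \<noteq> v \<longrightarrow> functional f v < functional f x)"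
  proof
    assume min: "minimizers S f = {v}"
    show "\<forall>x\<in>S. x \<noteq> v \<longrightarrow> functional f v < functional f x"
    proof (intro ballI impI, rule ccontr)
      fix x assume x: "x \<in> S" "x \<noteq> v" "\<not> functional f v < functional f x"
      have "functional f v \<le> functional f w" if "w \<in> S" for w
        using min that unfolding minimizers_def by blast
      then have "x \<in> minimizers S f"
        using x by (fastforce simp: minimizers_def)
      then show False
        using x min by blast
    qed
  qed (use True in \<open>force simp: minimizers_def\<close>)
  also have "\<dots> \<longleftrightarrow> S \<inter> ({x. g \<bullet> x = c} \<inter> {x. functional f x \<le> functional f v}) = {}"
  proof
    assume "\<forall>x\<in>S. x \<noteq> v \<longrightarrow> functional f v < functional f x"
    then show "S \<inter> ({x. g \<bullet> x = c} \<inter> {x. functional f x \<le> functional f v}) = {}"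
      using g by force
  next
    assume empty: "S \<inter> ({x. g \<bullet> x = c} \<inter> {x. functional f x \<le> functional f v}) = {}"
    show "\<forall>x\<in>S. x \<noteq> v \<longrightarrow> functional f v < functional f x"
    proof (intro ballI impI, rule ccontr)
      fix x assume x: "x \<in> S" "x \<noteq> v" "\<not> functional f v < functional f x"
      obtain y where "y \<in> S" "g \<bullet> y = c" "functional f y \<le> functional f v"
        using ex_point_on_cutting_hyperplane[OF S True g _ x(1,2), of "\<chi> i. real (f i)"] others x(3)
        by (auto simp: functional_eq_inner vertices_def)
      then show False
        using empty by blast
    qed
  qed
  finally show ?thesis
    using True by simp
next
  case False
  have "S = convex hull (vertices S)"
    using polytope_eq_hull_extreme_points[OF S] by (simp add: vertices_def)
  also have "\<dots> \<subseteq> {x. c < g \<bullet> x}"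
    using others False vertex_mem by (intro hull_minimal convex_halfspace_gt) auto
  finally have "S \<inter> ({x. g \<bullet> x = c} \<inter> {x. functional f x \<le> functional f v}) = {}"
    by auto
  moreover have "minimizers S f \<noteq> {v}"
    using False by (auto simp: minimizers_def)
  ultimately show ?thesis
    using False by simp
qed

text \<open>The set \<open>V\<close> will be the set of vertices of the whole polytope, so that the
  sums for all intersections of pieces have a common index set and can be interchanged with the
  alternating sum.\<close>

lemma generic_indicator:
  assumes "finite V" "vertices S \<subseteq> V" "V \<inter> S \<subseteq> vertices S"
  shows "(of_bool (generic S f) :: int) = (\<Sum>v\<in>V. of_bool (minimizers S f = {v}))"
proof (cases "generic S f")
  case True
  then obtain v where v: "v \<in> vertices S" "minimizers S f = {v}"
    by (auto simp: generic_def)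
  then have "(\<Sum>u\<in>V. of_bool (minimizers S f = {u})) = (\<Sum>u\<in>V. if u = v then 1 else (0::int))"
    by (intro sum.cong) auto
  then show ?thesis
    using True v assms by auto
next
  case False
  have "minimizers S f \<noteq> {v}" if "v \<in> V" for v
  proof
    assume "minimizers S f = {v}"
    moreover then have "v \<in> S"
      by (auto simp: minimizers_def)
    ultimately show False
      using False that assms by (auto simp: generic_def)
  qed
  then show ?thesis
    using False by simp
qed

text \<open>An intersection of pieces is a face of each of them, so its vertices are vertices of
  pieces and hence of Q. One hyperplane cutting off v from the other vertices of Q therefore serves
  for all intersections at once.\<close>

lemma generic_inclusion_exclusion:
  fixes R :: "'i \<Rightarrow> (real ^ 'n::finite) set"
  assumes fin: "finite I" and Q: "polytope Q" "Q = (\<Union>i\<in>I. R i)"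
    and R: "\<And>i. i \<in> I \<Longrightarrow> polytope (R i)" "\<And>i. i \<in> I \<Longrightarrow> vertices (R i) \<subseteq> vertices Q"
    and face: "\<And>i j. i \<in> I \<Longrightarrow> j \<in> I \<Longrightarrow> R i \<inter> R j face_of R i"
  shows "(of_bool (generic Q f) :: int)
    = (\<Sum>J | J \<subseteq> I \<and> J \<noteq> {}. (-1) ^ (card J + 1) * of_bool (generic (\<Inter>i\<in>J. R i) f))"
proof -
  let ?P = "{J. J \<subseteq> I \<and> J \<noteq> {}}"
  let ?R = "\<lambda>J. \<Inter>i\<in>J. R i"
  have RJ: "polytope (?R J) \<and> vertices (?R J) \<subseteq> vertices Q \<and> ?R J \<subseteq> Q" if J: "J \<in> ?P" for J
  proof -
    obtain i where i: "i \<in> J" "i \<in> I"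
      using J by auto
    have "\<Inter> ((\<lambda>j. R i \<inter> R j) ` J) face_of R i"
      using i J by (intro face_of_Inter) (auto intro: face)
    moreover have "\<Inter> ((\<lambda>j. R i \<inter> R j) ` J) = ?R J"
      using i by auto
    ultimately have F: "?R J face_of R i"
      by simp
    then have "vertices (?R J) \<subseteq> vertices (R i)"
      by (auto simp: vertices_def extreme_point_of_face)
    moreover have "polytope (?R J)"
      using F R(1)[OF i(2)] face_of_polytope_polytope by blast
    ultimately show ?thesis
      using R(2)[OF i(2)] i Q(2) by blast
  qed
  have Qvert: "vertices Q \<inter> S \<subseteq> vertices S" if "S \<subseteq> Q" for S
    using that by (auto simp: vertices_def extreme_point_of_def)
  have finV: "finite (vertices Q)"
    using Q(1) by (rule finite_vertices)
  have at_vertex: "(of_bool (minimizers Q f = {v}) :: int)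
      = (\<Sum>J\<in>?P. (-1) ^ (card J + 1) * of_bool (minimizers (?R J) f = {v}))" if v: "v \<in> vertices Q" for v
  proof -
    obtain g c where gc: "g \<bullet> v < c" "\<And>u. u \<in> vertices Q \<Longrightarrow> u \<noteq> v \<Longrightarrow> c < g \<bullet> u"
      using ex_hyperplane_cutting_vertex[OF Q(1), of v] v by (auto simp: vertices_def)
    define A where "A = {x. g \<bullet> x = c} \<inter> {x. functional f x \<le> functional f v}"
    have A: "closed A" "convex A"
      unfolding A_def functional_eq_inner
      by (intro closed_Int closed_hyperplane closed_halfspace_le convex_Int convex_hyperplane convex_halfspace_le)+
    \<comment> \<open>To be used with T = {v} and with T = A, the two sets in
      \<open>unique_minimizer_indicator\<close>.\<close>
    have ie: "(of_bool (Q \<inter> T \<noteq> {}) :: int)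
        = (\<Sum>J\<in>?P. (-1) ^ (card J + 1) * of_bool (?R J \<inter> T \<noteq> {}))" if T: "closed T" "convex T" for T
    proof -
      have QT: "Q \<inter> T = (\<Union>i\<in>I. R i \<inter> T)"
        using Q(2) by auto
      have "(of_bool ((\<Union>i\<in>I. R i \<inter> T) \<noteq> {}) :: int)
          = (\<Sum>J\<in>?P. (-1) ^ (card J + 1) * of_bool ((\<Inter>i\<in>J. R i \<inter> T) \<noteq> {}))"
      proof (rule inclusion_exclusion_nonempty[OF fin])
        show "compact (R i \<inter> T)" if "i \<in> I" for i
          using R(1)[OF that] T polytope_imp_compact by blast
        show "convex (R i \<inter> T)" if "i \<in> I" for i
          using R(1)[OF that] T polytope_imp_convex convex_Int by blast
        show "convex (\<Union>i\<in>I. R i \<inter> T)"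
          using Q(1) T polytope_imp_convex convex_Int unfolding QT[symmetric] by blast
      qed
      moreover have "(\<Inter>i\<in>J. R i \<inter> T) = ?R J \<inter> T" if "J \<in> ?P" for J
        using that by auto
      ultimately show ?thesis
        unfolding QT by simp
    qed
    have ind: "(of_bool (minimizers S f = {v}) :: int) = of_bool (S \<inter> {v} \<noteq> {}) - of_bool (S \<inter> A \<noteq> {})"
      if "polytope S" "vertices S \<subseteq> vertices Q" for S
      unfolding A_def using that gc by (intro unique_minimizer_indicator) auto
    have "of_bool (minimizers Q f = {v}) = (of_bool (Q \<inter> {v} \<noteq> {}) - of_bool (Q \<inter> A \<noteq> {}) :: int)"
      using ind Q(1) by blast
    also have "\<dots> = (\<Sum>J\<in>?P. (-1) ^ (card J + 1) * (of_bool (?R J \<inter> {v} \<noteq> {}) - of_bool (?R J \<inter> A \<noteq> {})))"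
      unfolding ie[OF A] ie[OF closed_singleton convex_singleton]
      by (simp only: sum_subtractf right_diff_distrib)
    also have "\<dots> = (\<Sum>J\<in>?P. (-1) ^ (card J + 1) * of_bool (minimizers (?R J) f = {v}))"
      using ind RJ by (intro sum.cong) auto
    finally show ?thesis .
  qed
  have "(of_bool (generic Q f) :: int) = (\<Sum>v\<in>vertices Q. of_bool (minimizers Q f = {v}))"
    using finV by (intro generic_indicator) auto
  also have "\<dots> = (\<Sum>v\<in>vertices Q. \<Sum>J\<in>?P. (-1) ^ (card J + 1) * of_bool (minimizers (?R J) f = {v}))"
    by (intro sum.cong refl at_vertex)
  also have "\<dots> = (\<Sum>J\<in>?P. \<Sum>v\<in>vertices Q. (-1) ^ (card J + 1) * of_bool (minimizers (?R J) f = {v}))"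
    by (rule sum.swap)
  also have "\<dots> = (\<Sum>J\<in>?P. (-1) ^ (card J + 1) * of_bool (generic (?R J) f))"
  proof (intro sum.cong refl)
    fix J assume J: "J \<in> ?P"
    show "(\<Sum>v\<in>vertices Q. (-1) ^ (card J + 1) * of_bool (minimizers (?R J) f = {v}))
        = ((-1) ^ (card J + 1) * of_bool (generic (?R J) f) :: int)"
      using RJ[OF J] Qvert[of "?R J"] generic_indicator[OF finV, of "?R J" f]
      by (simp add: sum_distrib_left)
  qed
  finally show ?thesis .
qed

lemma F_poly_eq: "F_poly Q m = (\<Sum>f | f \<in> pos_maps \<and> x_mon f = m. of_bool (generic Q f))"
proof -
  have "finite {f \<in> pos_maps. x_mon f = m}"
    by (rule finite_subset[OF _ finite_x_mon[of m]]) auto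
  then show ?thesis
    unfolding F_poly_def formal_sum_def by (intro sum.mono_neutral_cong_left) auto
qed

lemma F_poly_empty: "F_poly {} m = 0"
  by (simp add: F_poly_eq generic_def minimizers_def)

lemma F_poly_inclusion_exclusion:
  fixes R :: "nat \<Rightarrow> (real ^ 'n::finite) set"
  assumes Q: "polytope Q" "Q = (\<Union>i\<in>{1..k}. R i)"
    and R: "\<And>i. i \<in> {1..k} \<Longrightarrow> polytope (R i)" "\<And>i. i \<in> {1..k} \<Longrightarrow> vertices (R i) \<subseteq> vertices Q"
    and face: "\<And>i j. i \<in> {1..k} \<Longrightarrow> j \<in> {1..k} \<Longrightarrow> R i \<inter> R j face_of R i"
  shows "F_poly Q m = (\<Sum>j=1..k. (-1) ^ (j - 1) *
    (\<Sum>J | J \<subseteq> {1..k} \<and> card J = j \<and> (\<Inter>i\<in>J. R i) \<noteq> {}. F_poly (\<Inter>i\<in>J. R i) m))"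
proof -
  let ?P = "{J. J \<subseteq> {1..k} \<and> J \<noteq> {}}"
  let ?R = "\<lambda>J. \<Inter>i\<in>J. R i"
  have finP: "finite ?P"
    by (rule finite_subset[of _ "Pow {1..k}"]) auto
  have card_range: "card J \<in> {1..k}" if "J \<in> ?P" for J
    using that card_mono[of "{1..k}" J] finite_subset[of J "{1..k}"]
    by (auto simp: Suc_le_eq card_gt_0_iff)
  have "F_poly Q m = (\<Sum>f | f \<in> pos_maps \<and> x_mon f = m.
      \<Sum>J\<in>?P. (-1) ^ (card J + 1) * of_bool (generic (?R J) f))"
    unfolding F_poly_eq by (intro sum.cong refl generic_inclusion_exclusion assms finite_atLeastAtMost)
  also have "\<dots> = (\<Sum>J\<in>?P. (-1) ^ (card J + 1) * F_poly (?R J) m)"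
    unfolding F_poly_eq by (subst sum.swap) (simp add: sum_distrib_left)
  also have "\<dots> = (\<Sum>j=1..k. \<Sum>J | J \<in> ?P \<and> card J = j. (-1) ^ (card J + 1) * F_poly (?R J) m)"
    by (rule sum.group[symmetric, OF finP finite_atLeastAtMost]) (use card_range in blast)
  also have "\<dots> = (\<Sum>j=1..k. (-1) ^ (j - 1) *
      (\<Sum>J | J \<subseteq> {1..k} \<and> card J = j \<and> ?R J \<noteq> {}. F_poly (?R J) m))"
  proof (intro sum.cong refl)
    fix j assume j: "j \<in> {1..k}"
    have sign: "(-1) ^ (j + 1) = ((-1) ^ (j - 1) :: int)"
      using j by (cases j) auto
    have "(\<Sum>J | J \<in> ?P \<and> card J = j. (-1) ^ (card J + 1) * F_poly (?R J) m)
        = (\<Sum>J | J \<in> ?P \<and> card J = j. (-1) ^ (j - 1) * F_poly (?R J) m)"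
      by (intro sum.cong refl) (metis (mono_tags, lifting) mem_Collect_eq sign)
    also have "\<dots> = (\<Sum>J | J \<subseteq> {1..k} \<and> card J = j \<and> ?R J \<noteq> {}. (-1) ^ (j - 1) * F_poly (?R J) m)"
      using j by (intro sum.mono_neutral_right finite_subset[OF _ finP]) (auto simp: F_poly_empty)
    finally show "(\<Sum>J | J \<in> ?P \<and> card J = j. (-1) ^ (card J + 1) * F_poly (?R J) m)
        = (-1) ^ (j - 1) * (\<Sum>J | J \<subseteq> {1..k} \<and> card J = j \<and> ?R J \<noteq> {}. F_poly (?R J) m)"
      by (simp add: sum_distrib_left)
  qed
  finally show ?thesis .
qed

subsection \<open>Sums of fundamental quasisymmetric functions\<close>

text \<open>The usual shift from weakly to strictly increasing sequences. Here \<open>e i\<close>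
  counts only the steps up to i that are outside S, since those in S are strict already. The last
  entry grows by n - 1 - |S|, which gives the new upper bound.\<close>

lemma bij_betw_shifted_lists:
  assumes "S \<subseteq> {1..<n}" "0 < n"
  defines "e \<equiv> \<lambda>i. card ({1..i} - S)"
  shows "bij_betw (\<lambda>l. map (\<lambda>i. l ! i + e i) [0..<n])
    {l. length l = n \<and> sorted l \<and> set l \<subseteq> {1..k} \<and> S \<subseteq> breaks (<) l}
    {l. length l = n \<and> sorted_wrt (<) l \<and> set l \<subseteq> {1..k + n - 1 - card S}}"
    (is "bij_betw ?f ?X ?Y")
proof -
  have e0: "e 0 = 0"
    by (simp add: e_def)
  have eSuc: "e (Suc i) = e i + (if Suc i \<in> S then 0 else 1)" for i
  proof -
    have "{1..Suc i} - S = (if Suc i \<in> S then {1..i} - S else insert (Suc i) ({1..i} - S))"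
      by (auto simp: le_Suc_eq)
    then show ?thesis
      by (simp add: e_def)
  qed
  have e_mono: "e i \<le> e j" if "i \<le> j" for i j
    unfolding e_def using that by (intro card_mono) auto
  have "finite S" "card S \<le> n - 1"
    using assms(1) finite_subset card_mono[of "{1..<n}" S] by auto
  have "e (n - 1) = card {1..n - 1} - card S"
    unfolding e_def using assms(1) \<open>finite S\<close> by (intro card_Diff_subset) fastforce+
  then have elast: "k + n - 1 - card S = k + e (n - 1)"
    using \<open>card S \<le> n - 1\<close> assms(2) by simp
  let ?g = "\<lambda>l. map (\<lambda>i. l ! i - e i) [0..<n]"
  have XY: "?f l \<in> ?Y" if "l \<in> ?X" for l
  proof -
    have l: "length l = n" "sorted l" "set l \<subseteq> {1..k}" "S \<subseteq> breaks (<) l"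
      using that by auto
    have "l ! i + e i < l ! Suc i + e (Suc i)" if "Suc i < n" for i
    proof (cases "Suc i \<in> S")
      case True
      then show ?thesis
        using l(4) by (auto simp: eSuc Suc_mem_breaks_iff)
    next
      case False
      then show ?thesis
        using l that by (auto simp: eSuc sorted_iff_nth_Suc less_Suc_eq_le)
    qed
    then have "sorted_wrt (<) (?f l)"
      by (subst sorted_wrt_iff_nth_Suc_transp) auto
    moreover have "l ! i + e i \<in> {1..k + e (n - 1)}" if "i < n" for i
    proof -
      have "l ! i \<in> {1..k}"
        using l that nth_mem by blast
      then show ?thesis
        using e_mono[OF Suc_leI[OF that, THEN diff_le_mono[where l = 1]]] by auto
    qed
    ultimately show ?thesis
      using elast by auto
  qed
  \<comment> \<open>This makes the subtraction in the inverse map exact and its results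
    positive.\<close>
  have ge: "e i < b ! i" if b: "b \<in> ?Y" and "i < n" for b i
    using that(2)
  proof (induction i)
    case 0
    then have "b ! 0 \<in> set b"
      using b by auto
    then show ?case
      using b e0 by auto
  next
    case (Suc i)
    have "b ! i < b ! Suc i"
      using b Suc.prems sorted_wrt_nth_less[of "(<)" b i "Suc i"] by auto
    then show ?case
      using Suc by (simp add: eSuc)
  qed
  have YX: "?g b \<in> ?X" if b: "b \<in> ?Y" for b
  proof -
    have step: "b ! i < b ! Suc i" if "Suc i < n" for i
      using b that sorted_wrt_nth_less[of "(<)" b i "Suc i"] by auto
    have sorted: "sorted (?g b)"
      unfolding sorted_iff_nth_Suc
    proof (intro allI impI)
      fix i assume "Suc i < length (?g b)"
      then have i: "Suc i < n" by simp
      show "?g b ! i \<le> ?g b ! Suc i"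
        using i step[OF i] ge[OF b, of i] by (auto simp: eSuc)
    qed
    have "b ! i - e i \<in> {1..k}" if "i < n" for i
    proof -
      have "b ! (n - 1) \<in> set b"
        using b assms(2) by auto
      then have "b ! (n - 1) \<le> k + e (n - 1)"
        using b elast by auto
      moreover have "?g b ! i \<le> ?g b ! (n - 1)"
        using sorted that by (intro sorted_nth_mono) auto
      ultimately have "b ! i - e i \<le> k"
        using that by simp
      then show ?thesis
        using ge[OF b that] by simp
    qed
    moreover have "S \<subseteq> breaks (<) (?g b)"
    proof
      fix s assume "s \<in> S"
      then obtain i where i: "s = Suc i" "Suc i < n"
        using assms(1) by (cases s) auto
      then show "s \<in> breaks (<) (?g b)"
        using step[OF i(2)] ge[OF b, of i] \<open>s \<in> S\<close> by (auto simp: Suc_mem_breaks_iff eSuc)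
    qed
    ultimately show ?thesis
      using sorted by auto
  qed
  show ?thesis
  proof (rule bij_betw_byWitness[where f' = ?g])
    show "\<forall>l\<in>?X. ?g (?f l) = l"
      by (auto intro!: nth_equalityI)
    show "\<forall>b\<in>?Y. ?f (?g b) = b"
    proof
      fix b assume b: "b \<in> ?Y"
      then show "?f (?g b) = b"
        using ge[OF b] by (intro nth_equalityI) (auto simp: less_imp_le)
    qed
    show "?f ` ?X \<subseteq> ?Y" "?g ` ?Y \<subseteq> ?X"
      using XY YX by blast+
  qed
qed

lemma card_strictly_sorted_lists:
  "card {l. length l = n \<and> sorted_wrt (<) l \<and> set l \<subseteq> {1..N::nat}} = N choose n"
proof -
  have "bij_betw set {l. length l = n \<and> sorted_wrt (<) l \<and> set l \<subseteq> {1..N}} {B. B \<subseteq> {1..N} \<and> card B = n}"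
  proof (rule bij_betw_byWitness[where f' = sorted_list_of_set])
    show "\<forall>B\<in>{B. B \<subseteq> {1..N} \<and> card B = n}. set (sorted_list_of_set B) = B"
    proof
      fix B assume "B \<in> {B. B \<subseteq> {1..N} \<and> card B = n}"
      then have "finite B"
        using finite_subset by blast
      then show "set (sorted_list_of_set B) = B"
        by simp
    qed
    show "sorted_list_of_set ` {B. B \<subseteq> {1..N} \<and> card B = n}
        \<subseteq> {l. length l = n \<and> sorted_wrt (<) l \<and> set l \<subseteq> {1..N}}"
    proof clarify
      fix B assume B: "B \<subseteq> {1..N}" "n = card B"
      then have "finite B"
        using finite_subset by blast
      then show "length (sorted_list_of_set B) = card B \<and> sorted_wrt (<) (sorted_list_of_set B)
          \<and> set (sorted_list_of_set B) \<subseteq> {1..N}"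
        using B by simp
    qed
    show "set ` {l. length l = n \<and> sorted_wrt (<) l \<and> set l \<subseteq> {1..N}} \<subseteq> {B. B \<subseteq> {1..N} \<and> card B = n}"
      by (auto simp: strict_sorted_iff distinct_card)
  qed (auto simp: strict_sorted_iff sorted_list_of_set.idem_if_sorted_distinct)
  then show ?thesis
    using n_subsets[of "{1..N}" n] by (simp add: bij_betw_same_card)
qed

text \<open>The value of the fundamental function with descent set S when the first k variables are
  1 and the others 0.\<close>

lemma card_monomials_with_breaks:
  assumes "S \<subseteq> {1..<n}" "0 < n"
  shows "card {m. size m = n \<and> set_mset m \<subseteq> {1..k} \<and> S \<subseteq> mset_breaks m} = (k + n - 1 - card S) choose n"
proof -
  have "bij_betw mset {l. length l = n \<and> sorted l \<and> set l \<subseteq> {1..k} \<and> S \<subseteq> breaks (<) l}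
      {m. size m = n \<and> set_mset m \<subseteq> {1..k} \<and> S \<subseteq> mset_breaks m}"
  proof (rule bij_betw_byWitness[where f' = sorted_list_of_multiset])
    have "length (sorted_list_of_multiset m) = size m" for m :: monomial
      by (metis mset_sorted_list_of_multiset size_mset)
    then show "sorted_list_of_multiset ` {m. size m = n \<and> set_mset m \<subseteq> {1..k} \<and> S \<subseteq> mset_breaks m}
        \<subseteq> {l. length l = n \<and> sorted l \<and> set l \<subseteq> {1..k} \<and> S \<subseteq> breaks (<) l}"
      by auto
  qed (auto simp: sorted_sort_id)
  then have "card {m. size m = n \<and> set_mset m \<subseteq> {1..k} \<and> S \<subseteq> mset_breaks m}
      = card {l. length l = n \<and> sorted l \<and> set l \<subseteq> {1..k} \<and> S \<subseteq> breaks (<) l}"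
    by (simp add: bij_betw_same_card)
  also have "\<dots> = card {l. length l = n \<and> sorted_wrt (<) l \<and> set l \<subseteq> {1..k + n - 1 - card S}}"
    using bij_betw_shifted_lists[OF assms] by (rule bij_betw_same_card)
  finally show ?thesis
    by (simp only: card_strictly_sorted_lists)
qed

lemma finite_monomials: "finite {m. size m = n \<and> set_mset m \<subseteq> {1..k::nat}}"
proof (rule finite_subset)
  show "{m. size m = n \<and> set_mset m \<subseteq> {1..k}} \<subseteq> mset ` {l. set l \<subseteq> {1..k} \<and> length l = n}"
  proof clarify
    fix m :: monomial assume "set_mset m \<subseteq> {1..k}"
    then show "m \<in> mset ` {l. set l \<subseteq> {1..k} \<and> length l = size m}"
      by (intro image_eqI[of _ _ "sorted_list_of_multiset m"])
        (auto, metis mset_sorted_list_of_multiset size_mset)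
  qed
  show "finite (mset ` {l. set l \<subseteq> {1..k} \<and> length l = n})"
    by (intro finite_imageI finite_lists_length_eq) simp
qed

text \<open>The binomial coefficient of x + n - 1 - d over n as a polynomial in x: the product of x
  - d, ..., x - d + n - 1, divided by n!. It specializes a single L_\<alpha> with d
  descents.\<close>

definition order_poly :: "nat \<Rightarrow> nat \<Rightarrow> rat poly" where
  "order_poly n d = smult (1 / fact n) (\<Prod>i<n. [:of_nat i - of_nat d, 1:])"

lemma poly_order_poly: "poly (order_poly n d) x = pochhammer (x - of_nat d) n / fact n"
  by (simp add: order_poly_def poly_prod pochhammer_prod lessThan_atLeast0 algebra_simps)

lemma poly_order_poly_of_nat:
  assumes "d < n"
  shows "poly (order_poly n d) (of_nat k) = of_nat ((k + n - 1 - d) choose n)"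
proof -
  have "(of_nat (k + n - 1 - d) :: rat) - of_nat n + 1 = of_nat k - of_nat d"
    using assms by (simp add: of_nat_diff)
  then show ?thesis
    by (simp add: poly_order_poly binomial_gbinomial gbinomial_pochhammer')
qed

text \<open>Negating x and reversing the n factors yields the product that starts at x - (n - 1 -
  d), and n - 1 - d is the size of the complementary descent set.\<close>

lemma poly_order_poly_minus:
  assumes "d < n"
  shows "poly (order_poly n d) (- x) = (-1) ^ n * poly (order_poly n (n - 1 - d)) x"
proof -
  have eq: "x + of_nat d - of_nat n + 1 = x - of_nat (n - 1 - d)"
    using assms by (simp add: of_nat_diff)
  have "pochhammer (- x - of_nat d) n = (-1) ^ n * pochhammer (x + of_nat d - of_nat n + 1) n"
    using pochhammer_minus[of "x + of_nat d" n] by simp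
  then show ?thesis
    unfolding eq poly_order_poly by simp
qed

text \<open>
  All statements except (vi) follow from a presentation of the series as a sum of fundamental
  quasisymmetric functions, indexed by a finite set of descent sets.
\<close>

locale fundamental_sum =
  fixes Z :: "'z set" and D :: "'z \<Rightarrow> nat set" and n :: nat and F :: fpseries
  assumes finite_Z: "finite Z" and D_subset: "\<And>z. z \<in> Z \<Longrightarrow> D z \<subseteq> {1..<n}" and n_pos: "0 < n"
    and F_eq: "\<And>m. F m = (\<Sum>z\<in>Z. L_fun (composition_of n (D z)) m)"
begin

lemma F_eq_of_bool: "F m = (\<Sum>z\<in>Z. of_bool (0 \<notin># m \<and> size m = n \<and> D z \<subseteq> mset_breaks m))"
  unfolding F_eq by (intro sum.cong) (auto simp: L_fun_composition_of[OF D_subset])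

lemma F_nonzero: "F m \<noteq> 0 \<Longrightarrow> 0 \<notin># m \<and> size m = n"
  using F_eq_of_bool[of m] by (auto intro: ccontr)

lemma quasisymmetric_F: "quasisymmetric F"
proof -
  have "F (power_mon \<alpha> hs) = F (power_mon \<alpha> js)"
    if \<alpha>: "composition \<alpha>" and hs: "hs \<in> increasing_indices (length \<alpha>)"
      and js: "js \<in> increasing_indices (length \<alpha>)" for \<alpha> hs js
  proof -
    have "0 \<notin># power_mon \<alpha> hs \<and> size (power_mon \<alpha> hs) = sum_list \<alpha>"
      if "hs \<in> increasing_indices (length \<alpha>)" for hs
      using that \<alpha> by (auto simp: increasing_indices_def set_power_mon size_power_mon)
    then show ?thesis
      using hs js \<alpha> by (simp add: F_eq_of_bool mset_breaks_power_mon)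
  qed
  then show ?thesis
    using F_nonzero unfolding quasisymmetric_def by (intro conjI) (blast, metis le_refl, blast)
qed

lemma card_D_less: "z \<in> Z \<Longrightarrow> card (D z) < n"
  using D_subset[of z] n_pos card_mono[of "{1..<n}" "D z"] by auto

definition coeff :: "nat list \<Rightarrow> int" where
  "coeff \<alpha> = int (card {z \<in> Z. composition_of n (D z) = \<alpha>})"

lemma coeff_nonneg: "0 \<le> coeff \<alpha>"
  by (simp add: coeff_def)

lemma coeff_support: "{\<alpha>. coeff \<alpha> \<noteq> 0} = (\<lambda>z. composition_of n (D z)) ` Z"
  using finite_Z by (auto simp: coeff_def)

text \<open>Taking for h the values of \<open>L_fun\<close> at a monomial, the constant 1, or the
  signed complementary functions gives the expansion, the sum of the coefficients and the
  antipode.\<close>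

lemma sum_coeff:
  fixes h :: "nat list \<Rightarrow> int"
  shows "(\<Sum>\<alpha> | coeff \<alpha> \<noteq> 0. coeff \<alpha> * h \<alpha>) = (\<Sum>z\<in>Z. h (composition_of n (D z)))"
proof -
  have "(\<Sum>z\<in>Z. h (composition_of n (D z))) = (\<Sum>\<alpha>\<in>(\<lambda>z. composition_of n (D z)) ` Z.
      \<Sum>z\<in>{z \<in> Z. composition_of n (D z) = \<alpha>}. h (composition_of n (D z)))"
    by (rule sum.image_gen[OF finite_Z])
  also have "\<dots> = (\<Sum>\<alpha>\<in>(\<lambda>z. composition_of n (D z)) ` Z. coeff \<alpha> * h \<alpha>)"
    by (intro sum.cong) (auto simp: coeff_def)
  finally show ?thesis
    by (simp add: coeff_support)
qed

lemma L_expansion_coeff: "L_expansion F coeff"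
  unfolding L_expansion_def
proof (intro conjI allI impI)
  show "finite {\<alpha>. coeff \<alpha> \<noteq> 0}"
    using finite_Z by (simp add: coeff_support)
  show "composition \<alpha>" if "coeff \<alpha> \<noteq> 0" for \<alpha>
  proof -
    have "\<alpha> \<in> (\<lambda>z. composition_of n (D z)) ` Z"
      using that coeff_support by blast
    then show ?thesis
      using composition_of(1)[OF D_subset] by auto
  qed
  show "F = (\<lambda>m. \<Sum>\<alpha> | coeff \<alpha> \<noteq> 0. coeff \<alpha> * L_fun \<alpha> m)"
    by (simp add: sum_coeff F_eq fun_eq_iff)
qed

lemma L_expansion_iff: "L_expansion F c \<longleftrightarrow> c = coeff"
  using L_expansion_unique L_expansion_coeff by blast

lemma sum_all_coeff: "(\<Sum>\<alpha> | coeff \<alpha> \<noteq> 0. coeff \<alpha>) = int (card Z)"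
  using sum_coeff[of "\<lambda>_. 1"] by simp

lemma coeff_replicate_1: "coeff (replicate n 1) = int (card {z \<in> Z. D z = {1..<n}})"
proof -
  have ps: "partial_sums (replicate n 1) = {1..<n}"
  proof -
    have "sum_list (take i (replicate n 1)) = i" if "i < n" for i
      using that by (simp add: sum_list_replicate)
    then show ?thesis
      unfolding partial_sums_def by (auto simp del: take_replicate) metis+
  qed
  have "composition_of n (D z) = replicate n 1 \<longleftrightarrow> D z = {1..<n}" if "z \<in> Z" for z
  proof
    show "D z = {1..<n}" if "composition_of n (D z) = replicate n 1"
      using that composition_of(3)[OF D_subset[OF \<open>z \<in> Z\<close>]] ps by simp
    show "composition_of n (D z) = replicate n 1" if "D z = {1..<n}"
      using composition_of[OF D_subset[OF \<open>z \<in> Z\<close>]] ps that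
      by (intro composition_eqI) (auto simp: composition_def sum_list_replicate)
  qed
  then show ?thesis
    unfolding coeff_def by (metis (mono_tags, lifting) Collect_cong)
qed

lemma antipode_F: "antipode F m = (-1) ^ n * (\<Sum>z\<in>Z. L_fun (composition_of n ({1..<n} - D z)) m)"
proof -
  have "L_coeff F = coeff"
    unfolding L_coeff_def by (rule the_equality) (simp_all add: L_expansion_iff)
  then have "antipode F m = (\<Sum>z\<in>Z. (-1) ^ sum_list (composition_of n (D z))
      * L_fun (comp_complement (composition_of n (D z))) m)"
    using sum_coeff[of "\<lambda>\<alpha>. (-1) ^ sum_list \<alpha> * L_fun (comp_complement \<alpha>) m"]
    by (simp add: antipode_def)
  also have "\<dots> = (\<Sum>z\<in>Z. (-1) ^ n * L_fun (composition_of n ({1..<n} - D z)) m)"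
    by (intro sum.cong refl)
      (simp add: composition_of(2)[OF D_subset] comp_complement_composition_of[OF D_subset])
  finally show ?thesis
    by (simp add: sum_distrib_left)
qed

lemma specialize_F: "of_int (specialize F k) = poly (\<Sum>z\<in>Z. order_poly n (card (D z))) (of_nat k)"
proof -
  let ?U = "{m. size m = n \<and> set_mset m \<subseteq> {1..k}}"
  have "specialize F k = (\<Sum>m\<in>?U. F m)"
    unfolding specialize_def using F_nonzero
    by (intro sum.mono_neutral_left finite_monomials) auto
  also have "\<dots> = (\<Sum>z\<in>Z. \<Sum>m\<in>?U. of_bool (0 \<notin># m \<and> size m = n \<and> D z \<subseteq> mset_breaks m))"
    unfolding F_eq_of_bool by (rule sum.swap)
  also have "\<dots> = (\<Sum>z\<in>Z. int ((k + n - 1 - card (D z)) choose n))"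
  proof (intro sum.cong refl)
    fix z assume z: "z \<in> Z"
    have "(\<Sum>m\<in>?U. of_bool (0 \<notin># m \<and> size m = n \<and> D z \<subseteq> mset_breaks m))
        = int (card (?U \<inter> {m. 0 \<notin># m \<and> size m = n \<and> D z \<subseteq> mset_breaks m}))"
      by (rule sum_of_bool_eq; rule finite_monomials)
    also have "?U \<inter> {m. 0 \<notin># m \<and> size m = n \<and> D z \<subseteq> mset_breaks m}
        = {m. size m = n \<and> set_mset m \<subseteq> {1..k} \<and> D z \<subseteq> mset_breaks m}"
      by auto
    finally show "(\<Sum>m\<in>?U. of_bool (0 \<notin># m \<and> size m = n \<and> D z \<subseteq> mset_breaks m))
        = int ((k + n - 1 - card (D z)) choose n)"
      using card_monomials_with_breaks[OF D_subset[OF z] n_pos] by simp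
  qed
  finally have "(of_int (specialize F k) :: rat) = (\<Sum>z\<in>Z. of_nat ((k + n - 1 - card (D z)) choose n))"
    by simp
  also have "\<dots> = (\<Sum>z\<in>Z. poly (order_poly n (card (D z))) (of_nat k))"
    by (intro sum.cong refl poly_order_poly_of_nat[symmetric] card_D_less)
  finally show ?thesis
    by (simp add: poly_sum)
qed

end

subsection \<open>The vertex posets\<close>

definition vertex_labels :: "(real ^ 'n) set \<Rightarrow> real ^ 'n \<Rightarrow> 'n::finite \<Rightarrow> nat" where
  "vertex_labels Q v = (SOME \<gamma>. strictly_labelled_poset (vertex_order Q v) \<gamma>)"

lemma strictly_labelled_vertex_order:
  assumes "generalized_permutohedron Q" "v \<in> vertices Q"
  shows "strictly_labelled_poset (vertex_order Q v) (vertex_labels Q v)"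
proof -
  have "partial_order_on UNIV (vertex_order Q v)"
    using assms polytope_imp_convex
    by (intro partial_order_on_vertex_order) (auto simp: generalized_permutohedron_def vertices_def)
  from someI_ex[OF ex_strict_labelling[OF this]] show ?thesis
    unfolding vertex_labels_def .
qed

lemma F_poset_eq_of_bool:
  "F_poset P \<gamma> m = (\<Sum>f | f \<in> pos_maps \<and> x_mon f = m. of_bool (f \<in> P_partitions P \<gamma>))"
proof -
  have "finite {f \<in> pos_maps. x_mon f = m}"
    by (rule finite_subset[OF _ finite_x_mon[of m]]) auto
  moreover have "P_partitions P \<gamma> \<subseteq> pos_maps"
    by (auto simp: P_partitions_def)
  ultimately show ?thesis
    unfolding F_poset_def formal_sum_def by (intro sum.mono_neutral_cong_left) auto
qed

lemma unique_minimizer_iff_P_partition: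
  assumes "generalized_permutohedron Q" "v \<in> vertices Q" "f \<in> pos_maps"
  shows "minimizers Q f = {v} \<longleftrightarrow> f \<in> P_partitions (vertex_order Q v) (vertex_labels Q v)"
  using assms
  by (simp add: vertex_unique_minimizer_iff strict_P_partitions[OF strictly_labelled_vertex_order])

lemma minimizes_iff_P_partition:
  assumes "generalized_permutohedron Q" "v \<in> vertices Q" "f \<in> pos_maps"
  shows "v \<in> minimizers Q f \<longleftrightarrow>
    f \<in> P_partitions (vertex_order Q v) (reverse_labels (vertex_labels Q v))"
  using assms
  by (simp add: vertex_minimizes_iff weak_P_partitions[OF strictly_labelled_vertex_order])

lemma F_poly_eq_sum_F_poset:
  assumes Q: "generalized_permutohedron Q"
  shows "F_poly Q m = (\<Sum>v\<in>vertices Q. F_poset (vertex_order Q v) (vertex_labels Q v) m)"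
proof -
  have fin: "finite (vertices Q)"
    using Q finite_vertices by (auto simp: generalized_permutohedron_def)
  have "F_poly Q m = (\<Sum>f | f \<in> pos_maps \<and> x_mon f = m.
      \<Sum>v\<in>vertices Q. of_bool (minimizers Q f = {v}))"
    unfolding F_poly_eq by (intro sum.cong refl generic_indicator fin) auto
  also have "\<dots> = (\<Sum>f | f \<in> pos_maps \<and> x_mon f = m.
      \<Sum>v\<in>vertices Q. of_bool (f \<in> P_partitions (vertex_order Q v) (vertex_labels Q v)))"
    by (intro sum.cong refl arg_cong[where f = of_bool] unique_minimizer_iff_P_partition[OF Q]) auto
  also have "\<dots> = (\<Sum>v\<in>vertices Q. F_poset (vertex_order Q v) (vertex_labels Q v) m)"
    unfolding F_poset_eq_of_bool by (rule sum.swap)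
  finally show ?thesis .
qed

lemma F_star_eq_sum_F_poset:
  assumes Q: "generalized_permutohedron Q"
  shows "F_star Q m = (\<Sum>v\<in>vertices Q. F_poset (vertex_order Q v) (reverse_labels (vertex_labels Q v)) m)"
proof -
  have fin: "finite (vertices Q)"
    using Q finite_vertices by (auto simp: generalized_permutohedron_def)
  have "F_star Q m = (\<Sum>f | f \<in> pos_maps \<and> x_mon f = m.
      \<Sum>v\<in>vertices Q. of_bool (v \<in> minimizers Q f))"
    unfolding F_star_def formal_sum_def using fin by simp
  also have "\<dots> = (\<Sum>f | f \<in> pos_maps \<and> x_mon f = m.
      \<Sum>v\<in>vertices Q. of_bool (f \<in> P_partitions (vertex_order Q v) (reverse_labels (vertex_labels Q v))))"
    by (intro sum.cong refl arg_cong[where f = of_bool] minimizes_iff_P_partition[OF Q]) auto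
  also have "\<dots> = (\<Sum>v\<in>vertices Q. F_poset (vertex_order Q v) (reverse_labels (vertex_labels Q v)) m)"
    unfolding F_poset_eq_of_bool by (rule sum.swap)
  finally show ?thesis .
qed

text \<open>
  A linear order of the coordinates is the same as an open chamber of the braid arrangement, and
  each chamber lies in the normal cone of exactly one vertex.
\<close>

lemma ex1_vertex_of_linear_order:
  fixes Q :: "(real ^ 'n::finite) set"
  assumes Q: "generalized_permutohedron Q" and xs: "xs \<in> permutations_of_set UNIV"
  shows "\<exists>!v. v \<in> vertices Q \<and> xs \<in> linear_extensions (vertex_order Q v)"
proof -
  note xs' = length_permutation[OF xs]
  \<comment> \<open>The position in \<open>xs\<close>, counted from 1 so that f is a map to positive
    numbers. As f has no ties, its standardization is \<open>xs\<close> for every labelling.\<close>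
  define f where "f x = the (map_of (zip xs [1..<Suc (length xs)]) x)" for x
  have f_nth: "f (xs ! i) = Suc i" if "i < length xs" for i
    using that xs'(3) by (simp add: f_def map_of_zip_nth del: upt_Suc)
  have ex_nth: "\<exists>i<length xs. x = xs ! i" for x
    using xs'(2) by (metis UNIV_I in_set_conv_nth)
  have "inj f"
    by (rule injI) (metis ex_nth f_nth nat.inject)
  have pos: "f \<in> pos_maps"
  proof -
    have "1 \<le> f x" for x
      using ex_nth[of x] f_nth by auto
    then show ?thesis
      by (simp add: pos_maps_def)
  qed
  have std: "standardized \<gamma> f xs" for \<gamma> :: "'n \<Rightarrow> nat"
    using f_nth by (simp add: sorted_wrt_iff_nth_less)
  have "minimizers Q f = {v} \<longleftrightarrow> xs \<in> linear_extensions (vertex_order Q v)"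
    if "v \<in> vertices Q" for v
  proof -
    have "labelled_poset (vertex_order Q v) (vertex_labels Q v)"
      using strictly_labelled_vertex_order[OF Q that] by (simp add: strictly_labelled_poset_def)
    then show ?thesis
      unfolding unique_minimizer_iff_P_partition[OF Q that pos]
      using P_partition_iff_linear_extension[OF inj_labels(1) xs std pos] by blast
  qed
  then have "v \<in> vertices Q \<and> minimizers Q f = {v} \<longleftrightarrow>
      v \<in> vertices Q \<and> xs \<in> linear_extensions (vertex_order Q v)" for v
    by blast
  then show ?thesis
    using injective_unique_minimizing_vertex[OF Q \<open>inj f\<close>] by simp
qed

text \<open>A common index set for the expansions of \<open>F_poly\<close> and
  \<open>F_star\<close>, which then differ only in the labels by which the descents are
  taken.\<close>

definition vertex_extensions :: "(real ^ 'n::finite) set \<Rightarrow> ((real ^ 'n) \<times> 'n list) set" where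
  "vertex_extensions Q = (SIGMA v:vertices Q. linear_extensions (vertex_order Q v))"

lemma finite_vertex_extensions:
  assumes "generalized_permutohedron Q"
  shows "finite (vertex_extensions Q)"
  unfolding vertex_extensions_def using assms
  by (intro finite_SigmaI finite_vertices) (auto simp: generalized_permutohedron_def)

text \<open>Each linear order extends the order of exactly one vertex, so forgetting the vertex is a
  bijection onto the permutations.\<close>

lemma card_vertex_extensions:
  fixes Q :: "(real ^ 'n::finite) set"
  assumes "generalized_permutohedron Q"
  shows "card (vertex_extensions Q) = fact CARD('n)"
proof -
  have ext: "xs \<in> permutations_of_set UNIV" if "xs \<in> linear_extensions P" for xs :: "'n list" and P
    using that by (simp add: linear_extensions_def)
  have "bij_betw snd (vertex_extensions Q) (permutations_of_set UNIV)"
    unfolding bij_betw_def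
  proof
    show "inj_on snd (vertex_extensions Q)"
      using ex1_vertex_of_linear_order[OF assms ext]
      by (fastforce simp: inj_on_def vertex_extensions_def)
    show "snd ` vertex_extensions Q = permutations_of_set UNIV"
    proof (intro equalityI subsetI)
      fix xs :: "'n list" assume "xs \<in> permutations_of_set UNIV"
      then obtain v where "v \<in> vertices Q" "xs \<in> linear_extensions (vertex_order Q v)"
        using ex1_vertex_of_linear_order[OF assms] by blast
      then show "xs \<in> snd ` vertex_extensions Q"
        by (force simp: vertex_extensions_def)
    qed (auto simp: vertex_extensions_def ext)
  qed
  then show ?thesis
    by (simp add: bij_betw_same_card)
qed

lemma descents_linear_extension_subset:
  assumes "xs \<in> linear_extensions (P :: 'p::finite rel)"
  shows "descents \<gamma> xs \<subseteq> {1..<CARD('p)}"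
  using breaks_subset[of _ xs] length_permutation(1)[of xs] assms
  by (simp add: linear_extensions_def)

lemma fundamental_sum_of_vertex_extensions:
  fixes Q :: "(real ^ 'n::finite) set"
  assumes Q: "generalized_permutohedron Q" and inj: "\<And>v. v \<in> vertices Q \<Longrightarrow> inj (\<gamma> v)"
    and F: "\<And>m. F m = (\<Sum>v\<in>vertices Q. F_poset (vertex_order Q v) (\<gamma> v) m)"
  shows "fundamental_sum (vertex_extensions Q) (\<lambda>(v, xs). descents (\<gamma> v) xs) CARD('n) F"
proof
  show "finite (vertex_extensions Q)"
    by (rule finite_vertex_extensions[OF Q])
  show "(case z of (v, xs) \<Rightarrow> descents (\<gamma> v) xs) \<subseteq> {1..<CARD('n)}" if "z \<in> vertex_extensions Q" for z
    using that descents_linear_extension_subset by (force simp: vertex_extensions_def)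
  have fin: "finite (vertices Q)"
    using Q finite_vertices by (auto simp: generalized_permutohedron_def)
  show "F m = (\<Sum>z\<in>vertex_extensions Q.
      L_fun (composition_of CARD('n) (case z of (v, xs) \<Rightarrow> descents (\<gamma> v) xs)) m)" for m
  proof -
    have "F m = (\<Sum>v\<in>vertices Q. \<Sum>xs\<in>linear_extensions (vertex_order Q v).
        L_fun (composition_of CARD('n) (descents (\<gamma> v) xs)) m)"
      unfolding F by (intro sum.cong refl F_poset_eq_sum_linear_extensions inj)
    also have "\<dots> = (\<Sum>(v, xs)\<in>vertex_extensions Q. L_fun (composition_of CARD('n) (descents (\<gamma> v) xs)) m)"
      unfolding vertex_extensions_def using fin by (intro sum.Sigma) auto
    finally show ?thesis
      by (simp add: case_prod_unfold)
  qed
qed simp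

theorem theorem9p2:
  fixes Q :: "(real ^ 'n::finite) set"
  assumes "generalized_permutohedron Q"
  shows
    "quasisymmetric (F_poly Q) \<and>
     (\<exists>(P :: real ^ 'n \<Rightarrow> 'n rel) (\<gamma> :: real ^ 'n \<Rightarrow> 'n \<Rightarrow> nat).
        (\<forall>v \<in> vertices Q. strictly_labelled_poset (P v) (\<gamma> v)) \<and>
        F_poly Q = (\<lambda>m. \<Sum>v\<in>vertices Q. F_poset (P v) (\<gamma> v) m)) \<and>
     ((\<exists>!c. L_expansion (F_poly Q) c) \<and>
      (\<forall>c. L_expansion (F_poly Q) c \<longrightarrow>
         (\<forall>\<alpha>. 0 \<le> c \<alpha>) \<and>
         (\<Sum>\<alpha> | c \<alpha> \<noteq> 0. c \<alpha>) = fact CARD('n) \<and>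
         c (replicate CARD('n) 1) = int (card (vertices Q)))) \<and>
     antipode (F_poly Q) = (\<lambda>m. (-1) ^ CARD('n) * F_star Q m) \<and>
     (\<exists>\<phi> \<phi>' :: rat poly.
        (\<forall>m::nat. poly \<phi> (of_nat m) = of_int (specialize (F_poly Q) m)) \<and>
        (\<forall>m::nat. poly \<phi>' (of_nat m) = of_int (specialize (F_star Q) m)) \<and>
        (\<forall>m. poly \<phi> (- m) = (-1) ^ CARD('n) * poly \<phi>' m)) \<and>
     (\<forall>(k::nat) (R :: nat \<Rightarrow> (real ^ 'n) set).
        (\<forall>i\<in>{1..k}. generalized_permutohedron (R i)) \<and>
        Q = (\<Union>i\<in>{1..k}. R i) \<and>
        (\<forall>i\<in>{1..k}. \<forall>j\<in>{1..k}. R i \<inter> R j face_of R i \<and> R i \<inter> R j face_of R j) \<and>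
        without_new_vertices Q k R \<longrightarrow>
        F_poly Q = (\<lambda>m. \<Sum>j=1..k. (-1) ^ (j - 1) *
          (\<Sum>J | J \<subseteq> {1..k} \<and> card J = j \<and> (\<Inter>i\<in>J. R i) \<noteq> {}.
             F_poly (\<Inter>i\<in>J. R i) m)))"
proof -
  note Q = assms
  let ?P = "vertex_order Q" and ?\<gamma> = "vertex_labels Q" and ?Z = "vertex_extensions Q"
  let ?N = "CARD('n)"
  let ?D = "\<lambda>(v, xs). descents (?\<gamma> v) xs" and ?D' = "\<lambda>(v, xs). descents (reverse_labels (?\<gamma> v)) xs"
  have poly: "polytope Q" and fin: "finite (vertices Q)"
    using Q finite_vertices by (auto simp: generalized_permutohedron_def)
  have strict: "strictly_labelled_poset (?P v) (?\<gamma> v)" if "v \<in> vertices Q" for v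
    using strictly_labelled_vertex_order[OF Q that] .
  have lab: "labelled_poset (?P v) (?\<gamma> v)" if "v \<in> vertices Q" for v
    using strict[OF that] by (simp add: strictly_labelled_poset_def)
  interpret F: fundamental_sum ?Z ?D ?N "F_poly Q"
    by (rule fundamental_sum_of_vertex_extensions[OF Q inj_labels(1)[OF lab] F_poly_eq_sum_F_poset[OF Q]])
  interpret F': fundamental_sum ?Z ?D' ?N "F_star Q"
    by (rule fundamental_sum_of_vertex_extensions[OF Q inj_labels(2)[OF lab] F_star_eq_sum_F_poset[OF Q]])
  \<comment> \<open>From this complementation come both the antipode formula, term by term, and the
    reciprocity of the polynomials, through \<open>card_D'\<close> below.\<close>
  have D': "?D' z = {1..<?N} - ?D z" if "z \<in> ?Z" for z
    using that descents_reverse_labels[OF lab] by (auto simp: vertex_extensions_def linear_extensions_def)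
  \<comment> \<open>The coefficient at (1,...,1) counts the pairs with full descent set, of which
    \<open>card_full_descents\<close> gives one for each vertex.\<close>
  have "{z \<in> ?Z. ?D z = {1..<?N}} = (SIGMA v:vertices Q. {xs \<in> linear_extensions (?P v). descents (?\<gamma> v) xs = {1..<?N}})"
    by (auto simp: vertex_extensions_def)
  then have "card {z \<in> ?Z. ?D z = {1..<?N}}
      = (\<Sum>v\<in>vertices Q. card {xs \<in> linear_extensions (?P v). descents (?\<gamma> v) xs = {1..<?N}})"
    using fin by (simp only:) (rule card_SigmaI, auto)
  also have "\<dots> = (\<Sum>v\<in>vertices Q. 1)"
    by (intro sum.cong refl card_full_descents strict)
  finally have coeff_ones: "F.coeff (replicate ?N 1) = int (card (vertices Q))"
    unfolding F.coeff_replicate_1 by simp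
  have sum_coeff: "(\<Sum>\<alpha> | F.coeff \<alpha> \<noteq> 0. F.coeff \<alpha>) = fact ?N"
    unfolding F.sum_all_coeff card_vertex_extensions[OF Q] by simp
  have antipode: "antipode (F_poly Q) m = (-1) ^ ?N * F_star Q m" for m
    unfolding F.antipode_F F'.F_eq by (simp add: D')
  define \<phi> \<phi>' where "\<phi> = (\<Sum>z\<in>?Z. order_poly ?N (card (?D z)))"
    and "\<phi>' = (\<Sum>z\<in>?Z. order_poly ?N (card (?D' z)))"
  have card_D': "card (?D' z) = ?N - 1 - card (?D z)" if "z \<in> ?Z" for z
    using D'[OF that] F.D_subset[OF that] by (simp add: card_Diff_subset finite_subset[OF F.D_subset[OF that]])
  have reciprocity: "poly \<phi> (- x) = (-1) ^ ?N * poly \<phi>' x" for x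
    unfolding \<phi>_def \<phi>'_def poly_sum sum_distrib_left
    by (intro sum.cong refl) (simp add: poly_order_poly_minus[OF F.card_D_less] card_D')
  have decomposition: "F_poly Q m = (\<Sum>j=1..k. (-1) ^ (j - 1) *
      (\<Sum>J | J \<subseteq> {1..k} \<and> card J = j \<and> (\<Inter>i\<in>J. R i) \<noteq> {}. F_poly (\<Inter>i\<in>J. R i) m))"
    if "\<forall>i\<in>{1..k}. generalized_permutohedron (R i)" "Q = (\<Union>i\<in>{1..k}. R i)"
      "\<forall>i\<in>{1..k}. \<forall>j\<in>{1..k}. R i \<inter> R j face_of R i \<and> R i \<inter> R j face_of R j"
      "without_new_vertices Q k R" for k R m
    using that unfolding generalized_permutohedron_def without_new_vertices_def
    by (intro F_poly_inclusion_exclusion[OF poly]) auto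
  show ?thesis
  proof (intro conjI)
    show "\<exists>(P :: real ^ 'n \<Rightarrow> 'n rel) (\<gamma> :: real ^ 'n \<Rightarrow> 'n \<Rightarrow> nat). (\<forall>v\<in>vertices Q. strictly_labelled_poset (P v) (\<gamma> v)) \<and>
        F_poly Q = (\<lambda>m. \<Sum>v\<in>vertices Q. F_poset (P v) (\<gamma> v) m)"
      using strict F_poly_eq_sum_F_poset[OF Q] by (intro exI[of _ ?P] exI[of _ ?\<gamma>]) (simp add: fun_eq_iff)
    show "\<exists>\<phi> \<phi>' :: rat poly.
        (\<forall>m::nat. poly \<phi> (of_nat m) = of_int (specialize (F_poly Q) m)) \<and>
        (\<forall>m::nat. poly \<phi>' (of_nat m) = of_int (specialize (F_star Q) m)) \<and>
        (\<forall>m. poly \<phi> (- m) = (-1) ^ ?N * poly \<phi>' m)"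
      using reciprocity F.specialize_F[folded \<phi>_def] F'.specialize_F[folded \<phi>'_def]
      by (intro exI[of _ \<phi>] exI[of _ \<phi>'] conjI allI) (simp_all only:)
    show "quasisymmetric (F_poly Q)"
      by (rule F.quasisymmetric_F)
    show "\<exists>!c. L_expansion (F_poly Q) c"
      by (simp add: F.L_expansion_iff)
    show "\<forall>c. L_expansion (F_poly Q) c \<longrightarrow> (\<forall>\<alpha>. 0 \<le> c \<alpha>) \<and>
         (\<Sum>\<alpha> | c \<alpha> \<noteq> 0. c \<alpha>) = fact ?N \<and> c (replicate ?N 1) = int (card (vertices Q))"
      unfolding F.L_expansion_iff using F.coeff_nonneg sum_coeff coeff_ones by simp
    show "antipode (F_poly Q) = (\<lambda>m. (-1) ^ ?N * F_star Q m)"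
      using antipode by (rule ext)
    show "\<forall>(k::nat) (R :: nat \<Rightarrow> (real ^ 'n) set).
        (\<forall>i\<in>{1..k}. generalized_permutohedron (R i)) \<and>
        Q = (\<Union>i\<in>{1..k}. R i) \<and>
        (\<forall>i\<in>{1..k}. \<forall>j\<in>{1..k}. R i \<inter> R j face_of R i \<and> R i \<inter> R j face_of R j) \<and>
        without_new_vertices Q k R \<longrightarrow>
        F_poly Q = (\<lambda>m. \<Sum>j=1..k. (-1) ^ (j - 1) *
          (\<Sum>J | J \<subseteq> {1..k} \<and> card J = j \<and> (\<Inter>i\<in>J. R i) \<noteq> {}.
             F_poly (\<Inter>i\<in>J. R i) m))"
      by (intro allI impI ext decomposition) (elim conjE, assumption)+
  qed
qed

end
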